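(* There exist initial data $u_0\in\mathcal{L}(1)$ for the truncated Szegő equation $$i\partial_t u=\Pi(|u|^2u)-S\,\Pi\big(|S^\dagger u|^2S^\dagger u\big)$$ whose solution $u$ has exponentially growing Sobolev norms at late times: there is a constant $c>0$ such that for every $s>\tfrac12$, $$\|u(t)\|_{H^s}\simeq e^{(2s-1)c|t|}\qquad\text{as }t\to\infty .$$
   Context: $L^2_+(\mathbb{S}^1)$ is the closed subspace of $L^2(\mathbb{S}^1)$ of functions $u=\sum_{n\ge 0}\alpha_ne^{in\theta}$; such $u$ is identified with $u(z)=\sum_{n\ge0}\alpha_nz^n$. $H^s_+(\mathbb{S}^1)=H^s(\mathbb{S}^1)\cap L^2_+(\mathbb{S}^1)$, with $\|u\|_{H^s}^2=\sum_{n\ge0}(1+n)^{2s}|\alpha_n|^2$. $\Pi:L^2(\mathbb{S}^1)\to L^2_+(\mathbb{S}^1)$ is the Szegő projector (removing negative Fourier modes). $S$ is the shift $Sh=e^{i\theta}h$ on $L^2_+$, and $S^\dagger$ is its adjoint, $(S^\dagger h)_n=h_{n+1}$. The equation is globally well-posed in $H^s_+(\mathbb{S}^1)$ for $s>1/2$; "the solution" is the one with $u(0)=u_0$. $\mathcal{L}(1)$ is the set of rational functions $u(z)=A(z)/B(z)$ where $A,B$ are complex polynomials of degree at most $1$ with no common factors, $\deg A=1$ or $\deg B=1$, and $B$ has no zeros in the closed unit disk. $f(t)\simeq g(t)$ as $t\to\infty$ means that there are constants $0<m\le M<\infty$ (possibly depending on $s$ and $u_0$) and $T$ with $m\,g(t)\le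 f(t)\le M\,g(t)$ for all $t\ge T$. *)

theory Defs
  imports "HOL-Analysis.Analysis" "HOL-Computational_Algebra.Computational_Algebra"
begin

text \<open>
  A function \<open>u = (\<Sum>n. \<alpha>\<^sub>n e\<^sup>i\<^sup>n\<^sup>\<theta>)\<close> on the circle without negative modes is represented by the
  power series of its Fourier coefficients, so \<open>fps_nth u n = \<alpha>\<^sub>n\<close>, and its value at a point
  \<open>z\<close> of the circle (or of the disk) is \<open>eval_fps u z\<close>.  For \<open>u\<close> in \<open>Hs_plus s\<close>, \<open>s > 1/2\<close>,
  this series converges absolutely on the closed disk.
\<close>

definition Hs_plus :: "real \<Rightarrow> complex fps set" where
  "Hs_plus s = {u. summable (\<lambda>n. (1 + real n) powr (2 * s) * (cmod (fps_nth u n))\<^sup>2)}"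

definition Hs_norm :: "real \<Rightarrow> complex fps \<Rightarrow> real" where
  "Hs_norm s u = sqrt (\<Sum>n. (1 + real n) powr (2 * s) * (cmod (fps_nth u n))\<^sup>2)"

text \<open>The Szego projector keeps the Fourier coefficients of index \<open>n \<ge> 0\<close> of a function on the
  unit circle (only the values \<open>f (cis \<theta>)\<close> matter).\<close>

definition szego_projector :: "(complex \<Rightarrow> complex) \<Rightarrow> complex fps" where
  "szego_projector f =
     Abs_fps (\<lambda>n. (LINT \<theta>:{0..2 * pi}|lborel. f (cis \<theta>) * cis (- (real n * \<theta>))) / (2 * pi))"

definition shift :: "complex fps \<Rightarrow> complex fps" where
  "shift h = fps_X * h"

definition shift_adj :: "complex fps \<Rightarrow> complex fps" where
  "shift_adj h = fps_shift 1 h"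

definition szego_cubic :: "complex fps \<Rightarrow> complex fps" where
  "szego_cubic u =
     szego_projector (\<lambda>z. complex_of_real ((cmod (eval_fps u z))\<^sup>2) * eval_fps u z)"

text \<open>Differentiability of a curve in the Hilbert space \<open>Hs_plus s\<close>.  Membership of \<open>v\<close> is
  required explicitly, since \<open>Hs_norm\<close> is meaningful on \<open>Hs_plus s\<close> only.\<close>

definition has_Hs_derivative ::
  "real \<Rightarrow> (real \<Rightarrow> complex fps) \<Rightarrow> complex fps \<Rightarrow> real \<Rightarrow> bool" where
  "has_Hs_derivative s u v t \<longleftrightarrow>
     v \<in> Hs_plus s \<and>
     ((\<lambda>h. Hs_norm s (fps_const (complex_of_real (1 / h)) * (u (t + h) - u t) - v))
        \<longlongrightarrow> 0) (at 0)"

text \<open>Global strong solutions in \<open>Hs_plus s\<close>.  For \<open>s > 1/2\<close> the right-hand side is a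
  continuous map of \<open>Hs_plus s\<close>, so these are exactly the distributional solutions that are
  continuous in time with values in \<open>Hs_plus s\<close>.\<close>

definition truncated_szego_solution ::
  "real \<Rightarrow> complex fps \<Rightarrow> (real \<Rightarrow> complex fps) \<Rightarrow> bool" where
  "truncated_szego_solution s u0 u \<longleftrightarrow>
     u 0 = u0 \<and> (\<forall>t. u t \<in> Hs_plus s) \<and>
     (\<exists>u'. \<forall>t. has_Hs_derivative s u (u' t) t \<and>
        fps_const \<i> * u' t = szego_cubic (u t) - shift (szego_cubic (shift_adj (u t))))"

text \<open>Members of the class are Taylor series at \<open>0\<close> of the rational functions \<open>A / B\<close>.\<close>

definition rational_L1 :: "complex fps set" where
  "rational_L1 = {u. \<exists>A B :: complex poly.
     degree A \<le> 1 \<and> degree B \<le> 1 \<and> coprime A B \<and> (degree A = 1 \<or> degree B = 1) \<and>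
     (\<forall>z. cmod z \<le> 1 \<longrightarrow> poly B z \<noteq> 0) \<and>
     (\<lambda>z. poly A z / poly B z) has_fps_expansion u}"

definition comparable_at_top :: "(real \<Rightarrow> real) \<Rightarrow> (real \<Rightarrow> real) \<Rightarrow> bool" where
  "comparable_at_top f g \<longleftrightarrow>
     (\<exists>m M T. 0 < m \<and> m \<le> M \<and> (\<forall>t\<ge>T. m * g t \<le> f t \<and> f t \<le> M * g t))"

end

theory Submission
  imports Defs
begin

text \<open>
  The functions \<open>u(z) = b + c z / (1 - p z)\<close> form an invariant manifold: subtracting the shifted cubic term
  removes all interactions of four modes of positive index, and what is left acts on \<open>(b, c, p)\<close> by
  \<open>i p' = b* c\<close>, \<open>i c' = 2 |b|\<^sup>2 c + 2 b S p\<close>, \<open>i b' = |b|\<^sup>2 b + 2 b S + S c p* / (1 - |p|\<^sup>2)\<close>,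
  where \<open>S = |c|\<^sup>2 / (1 - |p|\<^sup>2)\<close> and \<open>*\<close> denotes conjugation.  At a critical energy the conserved quantities make
  \<open>y = 1 - |p|\<^sup>2\<close> follow a homoclinic orbit, \<open>y = 15 / (15 + 8 sinh\<^sup>2 (\<surd>15 t / 2))\<close> in the example, so the pole
  \<open>1 / p\<close> approaches the unit circle exponentially fast.  Since \<open>|c|\<close> is proportional to \<open>y\<close>, the series
  \<open>|c|\<^sup>2 \<Sum> (n + 2)\<^sup>2\<^sup>s (1 - y)\<^sup>n\<close> is of order \<open>y\<^sup>1\<^sup>-\<^sup>2\<^sup>s\<close>, which gives the growth rate \<open>(2 s - 1) \<surd>15 / 2\<close>.
  Uniqueness is a Gronwall argument for the \<open>\<ell>\<^sup>1\<close> norm of the Fourier coefficients, in which the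
  nonlinearity is locally Lipschitz and which the \<open>H\<^sup>s\<close> norm dominates for \<open>s > 1/2\<close>.
\<close>

section \<open>The Wiener algebra\<close>

text \<open>Absolutely convergent Fourier series. Uniqueness is proved here rather than in
  \<open>Hs_plus\<close>, because products and projected products are estimated by mere
  rearrangement of double sums.\<close>

definition wiener :: "complex fps set" where
  "wiener = {f. summable (\<lambda>n. cmod (fps_nth f n))}"

definition wnorm :: "complex fps \<Rightarrow> real" where
  "wnorm f = (\<Sum>n. cmod (fps_nth f n))"

lemma wnorm_nonneg: "f \<in> wiener \<Longrightarrow> 0 \<le> wnorm f"
  by (auto simp: wnorm_def wiener_def intro: suminf_nonneg)

lemma sum_le_wnorm: "f \<in> wiener \<Longrightarrow> (\<Sum>n<N. cmod (fps_nth f n)) \<le> wnorm f"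
  unfolding wnorm_def wiener_def by (auto intro: sum_le_suminf)

text \<open>A uniform bound on partial sums yields membership and the norm bound together, so the
  closure properties below reduce to finite sums.\<close>

lemma wiener_wnorm_leI:
  assumes "\<And>N. (\<Sum>n<N. cmod (fps_nth f n)) \<le> B"
  shows "f \<in> wiener" "wnorm f \<le> B"
proof -
  show "f \<in> wiener"
    unfolding wiener_def using assms by (auto intro: summableI_nonneg_bounded[of _ B])
  then show "wnorm f \<le> B"
    unfolding wnorm_def wiener_def using assms by (auto intro!: suminf_le_const)
qed

lemma norm_nth_le_wnorm:
  assumes "f \<in> wiener"
  shows "cmod (fps_nth f n) \<le> wnorm f"
proof -
  have "cmod (fps_nth f n) \<le> (\<Sum>k<Suc n. cmod (fps_nth f k))"
    by (simp add: sum_nonneg)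
  also have "\<dots> \<le> wnorm f"
    using sum_le_wnorm[OF assms] by blast
  finally show ?thesis .
qed

lemma wnorm_eq_0D: "f \<in> wiener \<Longrightarrow> wnorm f = 0 \<Longrightarrow> f = 0"
  using norm_nth_le_wnorm[of f] by (auto simp: fps_eq_iff)

lemma wnorm_zero [simp]: "wnorm 0 = 0"
  by (simp add: wnorm_def)

lemma wiener_add:
  assumes "f \<in> wiener" "g \<in> wiener"
  shows "f + g \<in> wiener" "wnorm (f + g) \<le> wnorm f + wnorm g"
proof -
  have *: "(\<Sum>n<N. cmod (fps_nth (f + g) n)) \<le> wnorm f + wnorm g" for N
  proof -
    have "(\<Sum>n<N. cmod (fps_nth (f + g) n)) \<le> (\<Sum>n<N. cmod (fps_nth f n)) + (\<Sum>n<N. cmod (fps_nth g n))"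
      by (simp add: sum.distrib[symmetric] sum_mono norm_triangle_ineq)
    also have "\<dots> \<le> wnorm f + wnorm g"
      by (intro add_mono sum_le_wnorm assms)
    finally show ?thesis .
  qed
  show "f + g \<in> wiener" "wnorm (f + g) \<le> wnorm f + wnorm g"
    by (rule wiener_wnorm_leI, rule *)+
qed

lemma wiener_mult:
  assumes "f \<in> wiener" "g \<in> wiener"
  shows "f * g \<in> wiener" "wnorm (f * g) \<le> wnorm f * wnorm g"
proof -
  let ?c = "\<lambda>k. \<Sum>i\<le>k. cmod (fps_nth f i) * cmod (fps_nth g (k - i))"
  have c: "?c sums (wnorm f * wnorm g)"
    unfolding wnorm_def
    by (rule Cauchy_product_sums) (use assms in \<open>simp_all add: wiener_def\<close>)
  have *: "(\<Sum>n<N. cmod (fps_nth (f * g) n)) \<le> wnorm f * wnorm g" for N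
  proof -
    have "(\<Sum>n<N. cmod (fps_nth (f * g) n)) \<le> (\<Sum>n<N. ?c n)"
      unfolding fps_mult_nth atLeast0AtMost
      by (intro sum_mono) (simp add: norm_mult[symmetric] norm_sum)
    also have "\<dots> \<le> wnorm f * wnorm g"
      using sum_le_suminf[OF sums_summable[OF c], of "{..<N}"] sums_unique[OF c]
      by (simp add: sum_nonneg)
    finally show ?thesis .
  qed
  show "f * g \<in> wiener" "wnorm (f * g) \<le> wnorm f * wnorm g"
    by (rule wiener_wnorm_leI, rule *)+
qed

lemma wiener_const_mult:
  assumes "f \<in> wiener"
  shows "fps_const c * f \<in> wiener" "wnorm (fps_const c * f) = cmod c * wnorm f"
  using assms unfolding wiener_def wnorm_def
  by (auto simp: norm_mult intro: summable_mult suminf_mult)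

lemma wiener_uminus:
  assumes "f \<in> wiener"
  shows "- f \<in> wiener" "wnorm (- f) = wnorm f"
  using assms unfolding wiener_def wnorm_def by simp_all

lemma wiener_diff:
  assumes "f \<in> wiener" "g \<in> wiener"
  shows "f - g \<in> wiener" "wnorm (f - g) \<le> wnorm f + wnorm g"
  using wiener_add[OF assms(1) wiener_uminus(1)[OF assms(2)]] wiener_uminus(2)[OF assms(2)]
  by simp_all

lemma wnorm_diff_ge:
  assumes "f \<in> wiener" "g \<in> wiener"
  shows "\<bar>wnorm f - wnorm g\<bar> \<le> wnorm (f - g)"
proof -
  have "wnorm f \<le> wnorm (f - g) + wnorm g"
    using wiener_add(2)[OF wiener_diff(1)[OF assms] assms(2)] by simp
  moreover have "wnorm g \<le> wnorm f + wnorm (f - g)"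
    using wiener_diff(2)[OF assms(1) wiener_diff(1)[OF assms]] by simp
  ultimately show ?thesis by linarith
qed

lemma wiener_shift:
  assumes "f \<in> wiener"
  shows "shift f \<in> wiener" "wnorm (shift f) = wnorm f"
proof -
  have "(\<lambda>n. cmod (fps_nth f n)) sums wnorm f"
    using assms by (simp add: wiener_def wnorm_def summable_sums)
  then have "(\<lambda>n. cmod (fps_nth (shift f) (Suc n))) sums wnorm f"
    by (simp add: shift_def)
  then have "(\<lambda>n. cmod (fps_nth (shift f) n)) sums (wnorm f + cmod (fps_nth (shift f) 0))"
    by (subst (asm) sums_Suc_iff)
  then show "shift f \<in> wiener" "wnorm (shift f) = wnorm f"
    by (simp_all add: sums_iff shift_def wiener_def wnorm_def)
qed

lemma wiener_shift_adj:
  assumes "f \<in> wiener"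
  shows "shift_adj f \<in> wiener" "wnorm (shift_adj f) \<le> wnorm f"
proof -
  have *: "(\<Sum>n<N. cmod (fps_nth (shift_adj f) n)) \<le> wnorm f" for N
  proof -
    have "(\<Sum>n<N. cmod (fps_nth (shift_adj f) n)) \<le> (\<Sum>n<Suc N. cmod (fps_nth f n))"
      by (simp add: shift_adj_def sum.lessThan_Suc_shift del: sum.lessThan_Suc)
    also have "\<dots> \<le> wnorm f"
      by (rule sum_le_wnorm[OF assms])
    finally show ?thesis .
  qed
  show "shift_adj f \<in> wiener" "wnorm (shift_adj f) \<le> wnorm f"
    by (rule wiener_wnorm_leI, rule *)+
qed

text \<open>The modes of index \<open>n \<ge> 0\<close> of \<open>f\<close> times the conjugate of
  \<open>g\<close>: on the circle, conjugation moves the coefficient of index \<open>l\<close> to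
  index \<open>- l\<close>.\<close>

definition correlation :: "complex fps \<Rightarrow> complex fps \<Rightarrow> complex fps" where
  "correlation f g = Abs_fps (\<lambda>n. \<Sum>l. fps_nth f (n + l) * cnj (fps_nth g l))"

lemma correlation_summable_norm:
  assumes "f \<in> wiener" "g \<in> wiener"
  shows "summable (\<lambda>l. cmod (fps_nth f (n + l)) * cmod (fps_nth g l))"
proof (rule summable_comparison_test)
  show "summable (\<lambda>l. wnorm f * cmod (fps_nth g l))"
    using assms(2) by (simp add: wiener_def summable_mult)
  show "\<exists>N. \<forall>l\<ge>N. norm (cmod (fps_nth f (n + l)) * cmod (fps_nth g l)) \<le> wnorm f * cmod (fps_nth g l)"
    using norm_nth_le_wnorm[OF assms(1)] by (auto intro!: exI[of _ 0] mult_right_mono)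
qed

lemma correlation_summable:
  assumes "f \<in> wiener" "g \<in> wiener"
  shows "summable (\<lambda>l. fps_nth f (n + l) * cnj (fps_nth g l))"
  using correlation_summable_norm[OF assms, of n]
  by (intro summable_norm_cancel[of "\<lambda>l. fps_nth f (n + l) * cnj (fps_nth g l)"]) (simp add: norm_mult)

text \<open>Once the sums are interchanged, a fixed \<open>l\<close> sees only a block of
  consecutive coefficients of \<open>f\<close>, whose moduli add up to at most
  \<open>wnorm f\<close>.\<close>

lemma wiener_correlation:
  assumes "f \<in> wiener" "g \<in> wiener"
  shows "correlation f g \<in> wiener" "wnorm (correlation f g) \<le> wnorm f * wnorm g"
proof -
  have *: "(\<Sum>n<N. cmod (fps_nth (correlation f g) n)) \<le> wnorm f * wnorm g" for N
  proof -
    have "(\<Sum>n<N. cmod (fps_nth (correlation f g) n))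
        \<le> (\<Sum>n<N. \<Sum>l. cmod (fps_nth f (n + l)) * cmod (fps_nth g l))"
      using summable_norm[of "\<lambda>l. fps_nth f (n + l) * cnj (fps_nth g l)" for n]
        correlation_summable_norm[OF assms]
      by (intro sum_mono) (simp add: correlation_def norm_mult)
    also have "\<dots> = (\<Sum>l. \<Sum>n<N. cmod (fps_nth f (n + l)) * cmod (fps_nth g l))"
      by (intro suminf_sum[symmetric] correlation_summable_norm assms)
    also have "\<dots> \<le> (\<Sum>l. wnorm f * cmod (fps_nth g l))"
    proof (intro suminf_le summable_sum correlation_summable_norm assms summable_mult)
      fix l
      have "(\<Sum>n<N. cmod (fps_nth f (n + l))) \<le> (\<Sum>n<N + l. cmod (fps_nth f n))"
        by (subst sum.shift_bounds_nat_ivl[of _ 0 l N, simplified atLeast0LessThan add_0, symmetric]) (auto intro!: sum_mono2)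
      also have "\<dots> \<le> wnorm f"
        by (rule sum_le_wnorm[OF assms(1)])
      finally show "(\<Sum>n<N. cmod (fps_nth f (n + l)) * cmod (fps_nth g l)) \<le> wnorm f * cmod (fps_nth g l)"
        by (simp add: sum_distrib_right[symmetric] mult_right_mono)
    qed (use assms(2) in \<open>simp add: wiener_def\<close>)
    also have "\<dots> = wnorm f * wnorm g"
      using assms(2) by (simp add: wnorm_def[of g] wiener_def suminf_mult)
    finally show ?thesis .
  qed
  show "correlation f g \<in> wiener" "wnorm (correlation f g) \<le> wnorm f * wnorm g"
    by (rule wiener_wnorm_leI, rule *)+
qed

lemma correlation_diff:
  assumes "f \<in> wiener" "g \<in> wiener" "h \<in> wiener"
  shows "correlation (f - g) h = correlation f h - correlation g h" "correlation h (f - g) = correlation h f - correlation h g"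
  using correlation_summable[OF assms(1,3)] correlation_summable[OF assms(2,3)]
    correlation_summable[OF assms(3,1)] correlation_summable[OF assms(3,2)]
  by (simp_all add: correlation_def fps_eq_iff algebra_simps suminf_diff)

section \<open>The cubic nonlinearity in Fourier coefficients\<close>

lemma cis_coefficient_integral:
  "(LINT \<theta>:{0..2 * pi}|lborel. cis (of_int k * \<theta>)) = (if k = 0 then 2 * pi else 0)"
proof (cases "k = 0")
  case True
  then show ?thesis
    by (simp add: set_lebesgue_integral_def scaleR_conv_of_real)
next
  case False
  have "((\<lambda>\<theta>. cis (of_int k * \<theta>)) has_integral
      (cis (of_int k * (2 * pi)) / (\<i> * of_int k) - cis (of_int k * 0) / (\<i> * of_int k))) {0..2 * pi}"
  proof (rule fundamental_theorem_of_calculus)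
    fix x :: real
    show "((\<lambda>\<theta>. cis (of_int k * \<theta>) / (\<i> * of_int k)) has_vector_derivative cis (of_int k * x))
        (at x within {0..2 * pi})"
    proof -
      have "((\<lambda>z. exp (\<i> * of_int k * z) / (\<i> * of_int k)) has_field_derivative cis (of_int k * x)) (at (of_real x))"
        by (rule derivative_eq_intros refl | simp add: False)+ (simp add: cis_conv_exp mult_ac False)
      from has_vector_derivative_real_field[OF this, of "{0..2 * pi}"] show ?thesis
        by (simp add: cis_conv_exp mult.assoc)
    qed
  qed simp
  moreover have "cis (of_int k * (2 * pi)) = 1"
    using cis_multiple_2pi[of "of_int k"] by (simp add: mult_ac)
  ultimately have "((\<lambda>\<theta>. cis (of_int k * \<theta>)) has_integral 0) {0..2 * pi}"
    by simp
  moreover have "set_integrable lborel {0..2 * pi} (\<lambda>\<theta>. cis (of_int k * \<theta>))"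
    by (intro borel_integrable_atLeastAtMost' continuous_intros)
  ultimately show ?thesis
    using False by (simp add: set_borel_integral_eq_integral(2) integral_unique)
qed

text \<open>Termwise integration, dominated because \<open>e n\<close> is unimodular. The family
  \<open>e\<close> stays general since it is used with positive frequencies for one factor and with
  negative ones for the conjugated factor.\<close>

lemma set_integral_power_series:
  fixes f :: "complex fps" and g :: "real \<Rightarrow> complex"
  assumes f: "f \<in> wiener" and g: "continuous_on {a..b} g" and e: "\<And>n. continuous_on {a..b} (e n)"
    and e1: "\<And>n \<theta>. cmod (e n \<theta>) = 1"
  shows "(\<lambda>n. fps_nth f n * (LINT \<theta>:{a..b}|lborel. e n \<theta> * g \<theta>)) sums
         (LINT \<theta>:{a..b}|lborel. (\<Sum>n. fps_nth f n * e n \<theta>) * g \<theta>)"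
proof -
  let ?F = "\<lambda>n \<theta>. indicator {a..b} \<theta> *\<^sub>R (fps_nth f n * (e n \<theta> * g \<theta>))"
  have int_g: "set_integrable lborel {a..b} g"
    by (intro borel_integrable_atLeastAtMost' g)
  have norm_F: "norm (?F n \<theta>) = cmod (fps_nth f n) * norm (indicator {a..b} \<theta> *\<^sub>R g \<theta>)" for n \<theta>
    by (simp add: norm_mult e1)
  have "(\<lambda>n. integral\<^sup>L lborel (?F n)) sums (LINT \<theta>|lborel. (\<Sum>n. ?F n \<theta>))"
  proof (rule sums_integral)
    show "integrable lborel (?F n)" for n
      unfolding set_integrable_def[symmetric]
      by (intro borel_integrable_atLeastAtMost' continuous_intros g e)
    show "AE \<theta> in lborel. summable (\<lambda>n. norm (?F n \<theta>))"
      unfolding norm_F using f by (auto intro!: summable_mult2 simp: wiener_def)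
    show "summable (\<lambda>n. LINT \<theta>|lborel. norm (?F n \<theta>))"
      unfolding norm_F using f by (auto intro!: summable_mult2 simp: wiener_def)
  qed
  moreover have "(\<Sum>n. ?F n \<theta>) = indicator {a..b} \<theta> *\<^sub>R ((\<Sum>n. fps_nth f n * e n \<theta>) * g \<theta>)" for \<theta>
  proof -
    have "summable (\<lambda>n. fps_nth f n * e n \<theta>)"
      using f by (intro summable_norm_cancel[of "\<lambda>n. fps_nth f n * e n \<theta>"]) (simp add: norm_mult e1 wiener_def)
    from suminf_mult2[OF this, of "indicator {a..b} \<theta> *\<^sub>R g \<theta>"] show ?thesis
      by (simp add: scaleR_conv_of_real mult_ac)
  qed
  moreover have "integral\<^sup>L lborel (?F n) = fps_nth f n * (LINT \<theta>:{a..b}|lborel. e n \<theta> * g \<theta>)" for n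
  proof -
    have "set_integrable lborel {a..b} (\<lambda>\<theta>. e n \<theta> * g \<theta>)"
      by (intro borel_integrable_atLeastAtMost' continuous_intros g e)
    then show ?thesis
      unfolding set_lebesgue_integral_def by (simp add: mult.left_commute scaleR_conv_of_real)
  qed
  ultimately show ?thesis
    by (simp add: set_lebesgue_integral_def)
qed

lemma eval_fps_summable:
  assumes "f \<in> wiener" "cmod z = 1"
  shows "summable (\<lambda>n. cmod (fps_nth f n * z ^ n))"
  using assms by (simp add: wiener_def norm_mult norm_power)

lemma continuous_on_eval_fps_cis:
  assumes "f \<in> wiener"
  shows "continuous_on A (\<lambda>\<theta>. eval_fps f (cis \<theta>))"
proof -
  have "uniform_limit A (\<lambda>n \<theta>. \<Sum>i<n. fps_nth f i * cis \<theta> ^ i) (\<lambda>\<theta>. eval_fps f (cis \<theta>)) sequentially"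
    unfolding eval_fps_def
    by (rule Weierstrass_m_test[of _ _ "\<lambda>n. cmod (fps_nth f n)"])
      (use assms in \<open>simp_all add: wiener_def norm_mult norm_power\<close>)
  then show ?thesis
    by (rule uniform_limit_theorem[rotated]) (auto intro!: always_eventually continuous_intros)
qed

text \<open>Expanding first \<open>f\<close> and then the conjugate of \<open>g\<close> reduces the
  integral to orthogonality of characters, which keeps the index pairs with
  \<open>j = n + l\<close>.\<close>

lemma szego_projector_mult_cnj:
  assumes f: "f \<in> wiener" and g: "g \<in> wiener"
  shows "szego_projector (\<lambda>z. eval_fps f z * cnj (eval_fps g z)) = correlation f g"
proof (rule fps_ext)
  fix n
  let ?I = "\<lambda>h. LINT \<theta>:{0..2 * pi}|lborel. h \<theta> :: complex"
  let ?e = "\<lambda>j \<theta>. cis (real j * \<theta>)"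
  have inner: "?I (\<lambda>\<theta>. ?e j \<theta> * (cnj (eval_fps g (cis \<theta>)) * cis (- (real n * \<theta>))))
      = (if n \<le> j then 2 * pi * cnj (fps_nth g (j - n)) else 0)" for j
  proof -
    let ?G = "Abs_fps (\<lambda>l. cnj (fps_nth g l))"
    have G: "?G \<in> wiener"
      using g by (simp add: wiener_def)
    have ev: "cnj (eval_fps g (cis \<theta>)) = (\<Sum>l. fps_nth ?G l * cis (- (real l * \<theta>)))" for \<theta>
    proof -
      have "(\<lambda>l. fps_nth g l * cis \<theta> ^ l) sums eval_fps g (cis \<theta>)"
        unfolding eval_fps_def
        by (intro summable_sums summable_norm_cancel[OF eval_fps_summable] g) simp
      then have "(\<lambda>l. cnj (fps_nth g l * cis \<theta> ^ l)) sums cnj (eval_fps g (cis \<theta>))"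
        by (simp only: sums_cnj)
      from sums_unique[OF this] show ?thesis
        by (simp add: Complex.DeMoivre cis_cnj)
    qed
    have S: "(\<lambda>l. fps_nth ?G l * ?I (\<lambda>\<theta>. cis (- (real l * \<theta>)) * cis (real_of_int (int j - int n) * \<theta>)))
        sums ?I (\<lambda>\<theta>. (\<Sum>l. fps_nth ?G l * cis (- (real l * \<theta>))) * cis (real_of_int (int j - int n) * \<theta>))"
      by (rule set_integral_power_series[OF G, where e = "\<lambda>l \<theta>. cis (- (real l * \<theta>))"])
        (intro continuous_intros, intro continuous_intros, simp)
    \<comment> \<open>The outer conditional isolates the single index as \<open>sums_single\<close>
      expects. For \<open>j < n\<close> the truncated \<open>j - n\<close> is 0, and the inner
      conditional supplies the correct value 0.\<close>
    have "(\<lambda>l. fps_nth ?G l * ?I (\<lambda>\<theta>. cis (- (real l * \<theta>)) * cis (real_of_int (int j - int n) * \<theta>)))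
        = (\<lambda>l. if l = j - n then (if n \<le> j then 2 * pi * cnj (fps_nth g l) else 0) else 0)"
    proof
      fix l
      have "(\<lambda>\<theta>. cis (- (real l * \<theta>)) * cis (real_of_int (int j - int n) * \<theta>))
          = (\<lambda>\<theta>. cis (real_of_int (int j - int n - int l) * \<theta>))"
        by (simp add: cis_mult algebra_simps)
      then show "fps_nth ?G l * ?I (\<lambda>\<theta>. cis (- (real l * \<theta>)) * cis (real_of_int (int j - int n) * \<theta>))
          = (if l = j - n then (if n \<le> j then 2 * pi * cnj (fps_nth g l) else 0) else 0)"
        by (simp only: cis_coefficient_integral) auto
    qed
    from sums_unique2[OF S[unfolded this] sums_single]
    have "?I (\<lambda>\<theta>. (\<Sum>l. fps_nth ?G l * cis (- (real l * \<theta>))) * cis (real_of_int (int j - int n) * \<theta>))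
        = (if n \<le> j then 2 * pi * cnj (fps_nth g (j - n)) else 0)" .
    moreover have "(\<lambda>\<theta>. ?e j \<theta> * (cnj (eval_fps g (cis \<theta>)) * cis (- (real n * \<theta>))))
        = (\<lambda>\<theta>. (\<Sum>l. fps_nth ?G l * cis (- (real l * \<theta>))) * cis (real_of_int (int j - int n) * \<theta>))"
      unfolding ev[symmetric] by (auto simp: fun_eq_iff cis_mult algebra_simps)
    ultimately show ?thesis by simp
  qed
  have "(\<lambda>j. fps_nth f j * ?I (\<lambda>\<theta>. ?e j \<theta> * (cnj (eval_fps g (cis \<theta>)) * cis (- (real n * \<theta>)))))
      sums ?I (\<lambda>\<theta>. (\<Sum>j. fps_nth f j * ?e j \<theta>) * (cnj (eval_fps g (cis \<theta>)) * cis (- (real n * \<theta>))))"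
    by (rule set_integral_power_series[OF f, where e = ?e])
      (intro continuous_intros continuous_on_eval_fps_cis g, intro continuous_intros, simp)
  then have *: "(\<lambda>j. fps_nth f j * (if n \<le> j then 2 * pi * cnj (fps_nth g (j - n)) else 0))
      sums ?I (\<lambda>\<theta>. eval_fps f (cis \<theta>) * cnj (eval_fps g (cis \<theta>)) * cis (- (real n * \<theta>)))"
    unfolding inner by (simp add: eval_fps_def Complex.DeMoivre mult.assoc)
  \<comment> \<open>The first \<open>n\<close> terms vanish, so the series may be reindexed by
    \<open>j = l + n\<close>.\<close>
  have "(\<lambda>l. fps_nth f (l + n) * (2 * pi * cnj (fps_nth g l)))
      sums ?I (\<lambda>\<theta>. eval_fps f (cis \<theta>) * cnj (eval_fps g (cis \<theta>)) * cis (- (real n * \<theta>)))"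
    using * sums_iff_shift[of "\<lambda>j. fps_nth f j * (if n \<le> j then 2 * pi * cnj (fps_nth g (j - n)) else 0)" n]
    by simp
  from sums_divide[OF this, of "2 * pi"]
  show "fps_nth (szego_projector (\<lambda>z. eval_fps f z * cnj (eval_fps g z))) n = fps_nth (correlation f g) n"
    by (simp add: szego_projector_def correlation_def sums_iff add.commute)
qed

text \<open>The circle may be the boundary of the disk of convergence, so the Cauchy product rests
  on absolute summability of the coefficients.\<close>

lemma eval_fps_mult_circle:
  assumes "f \<in> wiener" "g \<in> wiener" "cmod z = 1"
  shows "eval_fps (f * g) z = eval_fps f z * eval_fps g z"
proof -
  have "(\<Sum>k. \<Sum>i\<le>k. (fps_nth f i * z ^ i) * (fps_nth g (k - i) * z ^ (k - i))) = eval_fps f z * eval_fps g z"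
    unfolding eval_fps_def
    by (rule Cauchy_product[symmetric]) (use eval_fps_summable assms in auto)
  moreover have "(\<Sum>i\<le>k. (fps_nth f i * z ^ i) * (fps_nth g (k - i) * z ^ (k - i))) = fps_nth (f * g) k * z ^ k" for k
    unfolding fps_mult_nth atLeast0AtMost sum_distrib_right
    by (intro sum.cong refl) (auto simp: mult_ac power_add[symmetric])
  ultimately show ?thesis
    by (simp add: eval_fps_def)
qed

lemma szego_cubic_eq_correlation:
  assumes "f \<in> wiener"
  shows "szego_cubic f = correlation (f * f) f"
proof -
  have "szego_projector (\<lambda>z. complex_of_real ((cmod (eval_fps f z))\<^sup>2) * eval_fps f z)
      = szego_projector (\<lambda>z. eval_fps (f * f) z * cnj (eval_fps f z))"
    unfolding szego_projector_def
    by (simp add: eval_fps_mult_circle assms complex_norm_square del: of_real_power) (simp add: mult_ac)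
  then show ?thesis
    by (simp add: szego_cubic_def szego_projector_mult_cnj wiener_mult assms)
qed

definition truncated_szego_rhs :: "complex fps \<Rightarrow> complex fps" where
  "truncated_szego_rhs u = szego_cubic u - shift (szego_cubic (shift_adj u))"

lemma wiener_szego_cubic: "f \<in> wiener \<Longrightarrow> szego_cubic f \<in> wiener"
  by (simp add: szego_cubic_eq_correlation wiener_correlation wiener_mult)

text \<open>The cubic term is trilinear over the reals. Telescoping the difference costs
  \<open>2 * M\<^sup>2\<close> for the square and \<open>M\<^sup>2\<close> for the conjugated
  factor.\<close>

lemma szego_cubic_lipschitz:
  assumes f: "f \<in> wiener" "wnorm f \<le> M" and g: "g \<in> wiener" "wnorm g \<le> M"
  shows "wnorm (szego_cubic f - szego_cubic g) \<le> 3 * M\<^sup>2 * wnorm (f - g)"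
proof -
  note W = wiener_diff(1) wiener_mult(1) wiener_correlation(1) wiener_add(1) f g
  have M: "0 \<le> M" using wnorm_nonneg[OF f(1)] f(2) by simp
  have d: "0 \<le> wnorm (f - g)" by (intro wnorm_nonneg W)
  have ff: "wnorm (f * f - g * g) \<le> wnorm (f - g) * (2 * M)"
  proof -
    have "f * f - g * g = (f - g) * (f + g)" by (simp add: algebra_simps)
    then have "wnorm (f * f - g * g) \<le> wnorm (f - g) * wnorm (f + g)"
      using wiener_mult(2)[of "f - g" "f + g"] W by simp
    also have "\<dots> \<le> wnorm (f - g) * (2 * M)"
      using wiener_add(2)[of f g] f g d by (intro mult_left_mono) auto
    finally show ?thesis .
  qed
  have gg: "wnorm (g * g) \<le> M * M"
    using wiener_mult(2)[of g g] g mult_mono[of "wnorm g" M "wnorm g" M] M wnorm_nonneg[of g] by simp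
  have "szego_cubic f - szego_cubic g = correlation (f * f - g * g) f + correlation (g * g) (f - g)"
    by (simp add: szego_cubic_eq_correlation correlation_diff W)
  then have "wnorm (szego_cubic f - szego_cubic g) \<le> wnorm (correlation (f * f - g * g) f) + wnorm (correlation (g * g) (f - g))"
    by (simp add: wiener_add W)
  also have "\<dots> \<le> wnorm (f * f - g * g) * wnorm f + wnorm (g * g) * wnorm (f - g)"
    by (intro add_mono wiener_correlation(2) W)
  also have "\<dots> \<le> wnorm (f - g) * (2 * M) * M + M * M * wnorm (f - g)"
    using M d by (intro add_mono mult_mono ff gg f wnorm_nonneg W) auto
  finally show "wnorm (szego_cubic f - szego_cubic g) \<le> 3 * M\<^sup>2 * wnorm (f - g)"
    by (simp add: power2_eq_square algebra_simps)
qed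

lemma truncated_szego_rhs_lipschitz:
  assumes f: "f \<in> wiener" "wnorm f \<le> M" and g: "g \<in> wiener" "wnorm g \<le> M"
  shows "wnorm (truncated_szego_rhs f - truncated_szego_rhs g) \<le> 6 * M\<^sup>2 * wnorm (f - g)"
proof -
  let ?f = "shift_adj f" and ?g = "shift_adj g"
  have f': "?f \<in> wiener" "wnorm ?f \<le> M" and g': "?g \<in> wiener" "wnorm ?g \<le> M"
    using wiener_shift_adj[OF f(1)] wiener_shift_adj[OF g(1)] f g by auto
  have "?f - ?g = shift_adj (f - g)"
    by (simp add: shift_adj_def fps_eq_iff)
  then have fg: "wnorm (?f - ?g) \<le> wnorm (f - g)"
    by (simp add: wiener_shift_adj(2) wiener_diff f g)
  let ?a = "szego_cubic f - szego_cubic g" and ?b = "szego_cubic ?f - szego_cubic ?g"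
  have W: "?a \<in> wiener" "?b \<in> wiener"
    by (intro wiener_diff(1) wiener_szego_cubic f f' g g')+
  have "truncated_szego_rhs f - truncated_szego_rhs g = ?a - shift ?b"
    by (simp add: truncated_szego_rhs_def shift_def algebra_simps)
  then have "wnorm (truncated_szego_rhs f - truncated_szego_rhs g) \<le> wnorm ?a + wnorm ?b"
    using wiener_diff(2)[OF W(1) wiener_shift(1)[OF W(2)]] wiener_shift(2)[OF W(2)] by simp
  also have "\<dots> \<le> 3 * M\<^sup>2 * wnorm (f - g) + 3 * M\<^sup>2 * wnorm (?f - ?g)"
    by (intro add_mono szego_cubic_lipschitz f g f' g')
  also have "\<dots> \<le> 3 * M\<^sup>2 * wnorm (f - g) + 3 * M\<^sup>2 * wnorm (f - g)"
    by (intro add_mono mult_left_mono fg) auto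
  finally show ?thesis by (simp add: mult_ac)
qed

section \<open>Uniqueness of solutions\<close>

lemma Hs_plus_diff:
  assumes "f \<in> Hs_plus s" "g \<in> Hs_plus s"
  shows "f - g \<in> Hs_plus s"
proof -
  let ?w = "\<lambda>n. (1 + real n) powr (2 * s)"
  have "summable (\<lambda>n. 2 * (?w n * (cmod (fps_nth f n))\<^sup>2) + 2 * (?w n * (cmod (fps_nth g n))\<^sup>2))"
    using assms by (intro summable_add summable_mult) (simp_all add: Hs_plus_def)
  moreover have "norm (?w n * (cmod (fps_nth (f - g) n))\<^sup>2)
      \<le> 2 * (?w n * (cmod (fps_nth f n))\<^sup>2) + 2 * (?w n * (cmod (fps_nth g n))\<^sup>2)" for n
  proof -
    have "(cmod (fps_nth (f - g) n))\<^sup>2 \<le> (cmod (fps_nth f n) + cmod (fps_nth g n))\<^sup>2"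
      by (intro power_mono) (simp_all add: norm_triangle_ineq4)
    also have "\<dots> \<le> 2 * (cmod (fps_nth f n))\<^sup>2 + 2 * (cmod (fps_nth g n))\<^sup>2"
      using sum_squares_bound[of "cmod (fps_nth f n)" "cmod (fps_nth g n)"] by (simp add: power2_sum)
    finally have "?w n * (cmod (fps_nth (f - g) n))\<^sup>2
        \<le> ?w n * (2 * (cmod (fps_nth f n))\<^sup>2 + 2 * (cmod (fps_nth g n))\<^sup>2)"
      by (intro mult_left_mono) auto
    then show ?thesis
      by (simp add: algebra_simps)
  qed
  ultimately show ?thesis
    unfolding Hs_plus_def by (auto intro: summable_comparison_test')
qed

lemma Hs_plus_const_mult:
  assumes "f \<in> Hs_plus s"
  shows "fps_const c * f \<in> Hs_plus s"
  using summable_mult[of "\<lambda>n. (1 + real n) powr (2 * s) * (cmod (fps_nth f n))\<^sup>2" "(cmod c)\<^sup>2"] assms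
  by (simp add: Hs_plus_def norm_mult power_mult_distrib mult_ac)

text \<open>Cauchy-Schwarz with the weights \<open>(1 + n) powr s\<close> and
  \<open>(1 + n) powr (- s)\<close>; the squares of the latter are summable because
  \<open>2 * s > 1\<close>.\<close>

lemma Hs_plus_embeds_wiener:
  assumes "s > 1/2"
  obtains C where "C > 0" "\<And>f. f \<in> Hs_plus s \<Longrightarrow> f \<in> wiener \<and> wnorm f \<le> C * Hs_norm s f"
proof
  let ?v = "\<lambda>n. (1 + real n) powr (- (2 * s))"
  let ?C = "sqrt (\<Sum>n. ?v n)"
  have "summable (\<lambda>n. real (Suc n) powr (- (2 * s)))"
    unfolding summable_Suc_iff[of "\<lambda>n. real n powr (- (2 * s))"] summable_real_powr_iff using assms by simp
  then have v: "summable ?v" by (simp add: add.commute)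
  then show "?C > 0" by (simp add: suminf_pos)
  fix f assume f: "f \<in> Hs_plus s"
  have "(\<Sum>n<N. cmod (fps_nth f n)) \<le> ?C * Hs_norm s f" for N
  proof -
    let ?a = "\<lambda>n. (1 + real n) powr (- s)" and ?b = "\<lambda>n. (1 + real n) powr s * cmod (fps_nth f n)"
    have "(\<Sum>n<N. cmod (fps_nth f n)) = (\<Sum>n<N. \<bar>?a n\<bar> * \<bar>?b n\<bar>)"
      by (simp add: abs_mult mult.assoc[symmetric] powr_add[symmetric])
    also have "\<dots> \<le> L2_set ?a {..<N} * L2_set ?b {..<N}"
      by (rule L2_set_mult_ineq)
    also have "L2_set ?a {..<N} \<le> ?C"
      unfolding L2_set_def using v
      by (auto intro!: sum_le_suminf simp: power2_eq_square powr_add[symmetric])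
    also have "L2_set ?b {..<N} = sqrt (\<Sum>n<N. (1 + real n) powr (2 * s) * (cmod (fps_nth f n))\<^sup>2)"
      by (simp add: L2_set_def power2_eq_square powr_add[symmetric] mult_ac)
    also have "\<dots> \<le> Hs_norm s f"
      unfolding Hs_norm_def using f by (auto intro!: sum_le_suminf simp: Hs_plus_def)
    finally show ?thesis
      using v by (simp add: mult_left_mono mult_right_mono suminf_nonneg L2_set_nonneg)
  qed
  from wiener_wnorm_leI[OF this] show "f \<in> wiener \<and> wnorm f \<le> ?C * Hs_norm s f"
    by blast
qed

lemma truncated_szego_solution_wiener:
  assumes "s > 1/2" "truncated_szego_solution s u0 u"
  shows "u t \<in> wiener"
    and "\<exists>v. v \<in> wiener \<and> fps_const \<i> * v = truncated_szego_rhs (u t) \<and>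
      ((\<lambda>h. wnorm (fps_const (complex_of_real (1 / h)) * (u (t + h) - u t) - v)) \<longlongrightarrow> 0) (at 0)"
proof -
  obtain C where C: "C > 0" "\<And>f. f \<in> Hs_plus s \<Longrightarrow> f \<in> wiener \<and> wnorm f \<le> C * Hs_norm s f"
    using Hs_plus_embeds_wiener[OF assms(1)] by blast
  have u: "u t \<in> Hs_plus s" for t
    using assms(2) by (simp add: truncated_szego_solution_def)
  then show "u t \<in> wiener" using C by blast
  obtain v where v: "has_Hs_derivative s u v t" "fps_const \<i> * v = truncated_szego_rhs (u t)"
    using assms(2) unfolding truncated_szego_solution_def truncated_szego_rhs_def by metis
  let ?q = "\<lambda>h. fps_const (complex_of_real (1 / h)) * (u (t + h) - u t) - v"
  have v': "v \<in> Hs_plus s" and lim: "((\<lambda>h. Hs_norm s (?q h)) \<longlongrightarrow> 0) (at 0)"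
    using v(1) by (simp_all add: has_Hs_derivative_def)
  have q: "?q h \<in> Hs_plus s" for h
    by (intro Hs_plus_diff Hs_plus_const_mult u v')
  have "((\<lambda>h. wnorm (?q h)) \<longlongrightarrow> 0) (at 0)"
  proof (rule Lim_null_comparison)
    show "\<forall>\<^sub>F h in at 0. norm (wnorm (?q h)) \<le> C * Hs_norm s (?q h)"
      using C(2)[OF q] wnorm_nonneg by (intro always_eventually) auto
    show "((\<lambda>h. C * Hs_norm s (?q h)) \<longlongrightarrow> 0) (at 0)"
      using tendsto_mult_left[OF lim, of C] by simp
  qed
  then show "\<exists>v. v \<in> wiener \<and> fps_const \<i> * v = truncated_szego_rhs (u t) \<and>
      ((\<lambda>h. wnorm (fps_const (complex_of_real (1 / h)) * (u (t + h) - u t) - v)) \<longlongrightarrow> 0) (at 0)"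
    using v(2) C(2)[OF v'] by blast
qed

text \<open>A norm along a curve need not be differentiable, so only its increments are estimated,
  by the reverse triangle inequality; \<open>e\<close> absorbs the distance of the difference
  quotient from \<open>v\<close>.\<close>

lemma wnorm_increment_bound:
  assumes w: "\<And>t. w t \<in> wiener" and v: "v \<in> wiener"
    and lim: "((\<lambda>h. wnorm (fps_const (complex_of_real (1 / h)) * (w (t + h) - w t) - v)) \<longlongrightarrow> 0) (at 0)"
    and e: "e > 0"
  shows "\<forall>\<^sub>F h in at 0. \<bar>wnorm (w (t + h)) - wnorm (w t)\<bar> \<le> \<bar>h\<bar> * (wnorm v + e)"
proof -
  let ?q = "\<lambda>h. fps_const (complex_of_real (1 / h)) * (w (t + h) - w t) - v"
  have "\<forall>\<^sub>F h in at 0. wnorm (?q h) < e"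
    using order_tendstoD(2)[OF lim e] .
  then have "\<forall>\<^sub>F h in at 0. wnorm (?q h) < e \<and> h \<noteq> 0"
    by (rule eventually_conj) (simp add: eventually_at_filter)
  then show ?thesis
  proof eventually_elim
    case (elim h)
    have q: "?q h \<in> wiener"
      by (intro wiener_diff(1) wiener_const_mult(1) w v)
    have "w (t + h) - w t = fps_const (complex_of_real h) * (?q h + v)"
      using elim by (simp add: mult.assoc[symmetric])
    then have "wnorm (w (t + h) - w t) = wnorm (fps_const (complex_of_real h) * (?q h + v))"
      by (rule arg_cong)
    also have "\<dots> = \<bar>h\<bar> * wnorm (?q h + v)"
      by (subst wiener_const_mult(2)[OF wiener_add(1)[OF q v]]) simp
    also have "\<dots> \<le> \<bar>h\<bar> * (wnorm v + e)"
      using wiener_add(2)[OF q v] elim by (intro mult_left_mono) auto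
    finally show ?case
      using wnorm_diff_ge[OF w w, of "t + h" t] by linarith
  qed
qed

section \<open>Gronwall's argument from increment bounds, and uniqueness\<close>

lemma isCont_if_increment_bound:
  fixes f :: "real \<Rightarrow> real"
  assumes "\<forall>\<^sub>F h in at 0. \<bar>f (t + h) - f t\<bar> \<le> \<bar>h\<bar> * K"
  shows "isCont f t"
proof -
  have "((\<lambda>h. f (t + h) - f t) \<longlongrightarrow> 0) (at 0)"
  proof (rule Lim_null_comparison)
    show "\<forall>\<^sub>F h in at 0. norm (f (t + h) - f t) \<le> \<bar>h\<bar> * K"
      using assms by simp
    show "((\<lambda>h. \<bar>h\<bar> * K) \<longlongrightarrow> 0) (at 0)"
      by (auto intro!: tendsto_eq_intros)
  qed
  then show ?thesis
    by (simp add: isCont_iff LIM_zero_iff)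
qed

lemma gronwall_zero_of_increment_bound:
  fixes y :: "real \<Rightarrow> real"
  assumes T: "0 \<le> T" and y0: "y 0 = 0" and y_nonneg: "\<And>t. 0 \<le> y t"
    and incr: "\<And>t e. \<lbrakk>t \<in> {0..T}; e > 0\<rbrakk> \<Longrightarrow> \<forall>\<^sub>F h in at 0. \<bar>y (t + h) - y t\<bar> \<le> \<bar>h\<bar> * (K * y t + e)"
  shows "y T = 0"
proof -
  \<comment> \<open>At a positive maximum of \<open>?q\<close> the function \<open>y\<close> would have to grow at rate \<open>K + 1\<close>.\<close>
  let ?q = "\<lambda>t. y t * exp (- ((K + 1) * t))"
  have cont: "isCont y t" if "t \<in> {0..T}" for t
    using isCont_if_increment_bound[OF incr[OF that zero_less_one]] .
  have "continuous_on {0..T} ?q"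
    by (intro continuous_at_imp_continuous_on ballI continuous_intros cont)
  then obtain x where x: "x \<in> {0..T}" "\<And>t. t \<in> {0..T} \<Longrightarrow> ?q t \<le> ?q x"
    using continuous_attains_sup[of "{0..T}" ?q] T by auto
  have "y x = 0"
  proof (rule ccontr)
    assume "y x \<noteq> 0"
    with y_nonneg[of x] have yx: "y x > 0" by simp
    with y0 x have x0: "x > 0" by (cases "x = 0") auto
    \<comment> \<open>With slack \<open>y x / 2\<close> the increment bound gives
      \<open>y (x - h) \<ge> y x * (1 - (K + 1/2) * h)\<close>, while maximality gives
      \<open>y (x - h) \<le> y x * exp (- ((K + 1) * h))\<close>. The positive slope of
      \<open>?f\<close> at 0 makes these incompatible for small \<open>h > 0\<close>.\<close>
    let ?f = "\<lambda>h. exp ((K + 1) * h) - (K + 1/2) * h"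
    have "(?f has_real_derivative 1/2) (at 0)"
      by (auto intro!: derivative_eq_intros)
    then obtain d1 where d1: "d1 > 0" "\<And>h. 0 < h \<Longrightarrow> h < d1 \<Longrightarrow> ?f (0 - h) < ?f 0"
      using DERIV_pos_inc_left[of ?f "1/2" 0] by auto
    obtain d2 where d2: "d2 > 0" "\<And>h. h \<noteq> 0 \<Longrightarrow> \<bar>h\<bar> < d2 \<Longrightarrow> \<bar>y (x + h) - y x\<bar> \<le> \<bar>h\<bar> * (K * y x + y x / 2)"
      using incr[OF x(1), of "y x / 2"] yx by (auto simp: eventually_at dist_real_def)
    define h where "h = min x (min d1 d2) / 2"
    have h: "0 < h" "h < x" "h < d1" "h < d2"
      using x0 d1(1) d2(1) by (auto simp: h_def)
    have "y x - h * (K * y x + y x / 2) \<le> y (x - h)"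
      using d2(2)[of "- h"] h by auto
    also have "y (x - h) \<le> y x * exp (- ((K + 1) * h))"
      using x(2)[of "x - h"] x(1) h
      by (simp add: algebra_simps exp_diff exp_add divide_simps exp_minus)
    also have "\<dots> < y x * (1 - (K + 1/2) * h)"
      using d1(2)[OF h(1,3)] yx by (intro mult_strict_left_mono) auto
    finally show False by (simp add: algebra_simps)
  qed
  then have "?q T \<le> 0"
    using x(2)[of T] T by simp
  with y_nonneg[of T] show ?thesis
    by (simp add: mult_le_0_iff)
qed

theorem truncated_szego_solution_unique:
  assumes s: "s > 1/2" and u: "truncated_szego_solution s u0 u" and v: "truncated_szego_solution s u0 v"
  shows "u = v"
proof
  fix t :: real
  define T where "T = \<bar>t\<bar>"
  note Wu = truncated_szego_solution_wiener(1)[OF s u] and Wv = truncated_szego_solution_wiener(1)[OF s v]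
  have W: "u t - v t \<in> wiener" for t
    by (intro wiener_diff Wu Wv)
  \<comment> \<open>The nonlinearity is only locally Lipschitz, so both solutions must be bounded on
    the compact time interval; continuity of the norm provides this.\<close>
  have "\<exists>M. \<forall>x\<in>{-T..T}. wnorm (u x) \<le> M" if u: "truncated_szego_solution s u0 u" for u
  proof -
    have "isCont (\<lambda>t. wnorm (u t)) x" for x
    proof -
      from truncated_szego_solution_wiener(2)[OF s u, of x]
      obtain u' where "u' \<in> wiener"
        "((\<lambda>h. wnorm (fps_const (complex_of_real (1 / h)) * (u (x + h) - u x) - u')) \<longlongrightarrow> 0) (at 0)"
        by blast
      from isCont_if_increment_bound[OF wnorm_increment_bound[OF truncated_szego_solution_wiener(1)[OF s u] this zero_less_one]]
      show ?thesis .
    qed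
    then have "continuous_on {-T..T} (\<lambda>t. wnorm (u t))"
      by (simp add: continuous_at_imp_continuous_on)
    from continuous_attains_sup[OF _ _ this] show ?thesis
      by (force simp: T_def)
  qed
  from this[OF u] this[OF v] obtain M1 M2 where M12: "\<And>x. x \<in> {-T..T} \<Longrightarrow> wnorm (u x) \<le> M1"
    "\<And>x. x \<in> {-T..T} \<Longrightarrow> wnorm (v x) \<le> M2" by blast
  define M where "M = max M1 M2"
  have M: "wnorm (u x) \<le> M" "wnorm (v x) \<le> M" if "x \<in> {-T..T}" for x
    using M12[OF that] by (auto simp: M_def)
  let ?y = "\<lambda>t. wnorm (u t - v t)"
  have incr: "\<forall>\<^sub>F h in at 0. \<bar>?y (x + h) - ?y x\<bar> \<le> \<bar>h\<bar> * (6 * M\<^sup>2 * ?y x + e)"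
    if x: "x \<in> {-T..T}" and e: "e > 0" for x e
  proof -
    obtain u' where u': "u' \<in> wiener" "fps_const \<i> * u' = truncated_szego_rhs (u x)"
      "((\<lambda>h. wnorm (fps_const (complex_of_real (1 / h)) * (u (x + h) - u x) - u')) \<longlongrightarrow> 0) (at 0)"
      using truncated_szego_solution_wiener(2)[OF s u, of x] by blast
    obtain v' where v': "v' \<in> wiener" "fps_const \<i> * v' = truncated_szego_rhs (v x)"
      "((\<lambda>h. wnorm (fps_const (complex_of_real (1 / h)) * (v (x + h) - v x) - v')) \<longlongrightarrow> 0) (at 0)"
      using truncated_szego_solution_wiener(2)[OF s v, of x] by blast
    let ?qu = "\<lambda>h. fps_const (complex_of_real (1 / h)) * (u (x + h) - u x) - u'"
    let ?qv = "\<lambda>h. fps_const (complex_of_real (1 / h)) * (v (x + h) - v x) - v'"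
    let ?q = "\<lambda>h. fps_const (complex_of_real (1 / h)) * ((u (x + h) - v (x + h)) - (u x - v x)) - (u' - v')"
    have q: "?qu h \<in> wiener" "?qv h \<in> wiener" for h
      by (intro wiener_diff(1) wiener_const_mult(1) Wu Wv u' v')+
    have q_eq: "?q h = ?qu h - ?qv h" for h
      by (simp add: algebra_simps)
    have "((\<lambda>h. wnorm (?q h)) \<longlongrightarrow> 0) (at 0)"
    proof (rule Lim_null_comparison)
      show "\<forall>\<^sub>F h in at 0. norm (wnorm (?q h)) \<le> wnorm (?qu h) + wnorm (?qv h)"
        unfolding q_eq using wiener_diff[OF q] wnorm_nonneg by (intro always_eventually) auto
      show "((\<lambda>h. wnorm (?qu h) + wnorm (?qv h)) \<longlongrightarrow> 0) (at 0)"
        using tendsto_add[OF u'(3) v'(3)] by simp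
    qed
    from wnorm_increment_bound[OF W wiener_diff(1)[OF u'(1) v'(1)] this e]
    have ev: "\<forall>\<^sub>F h in at 0. \<bar>?y (x + h) - ?y x\<bar> \<le> \<bar>h\<bar> * (wnorm (u' - v') + e)" .
    have "fps_const \<i> * (u' - v') = truncated_szego_rhs (u x) - truncated_szego_rhs (v x)"
      using u'(2) v'(2) by (simp add: algebra_simps)
    then have "wnorm (u' - v') = wnorm (truncated_szego_rhs (u x) - truncated_szego_rhs (v x))"
      using wiener_const_mult(2)[OF wiener_diff(1)[OF u'(1) v'(1)], of \<i>] by simp
    also have "\<dots> \<le> 6 * M\<^sup>2 * ?y x"
      by (intro truncated_szego_rhs_lipschitz Wu Wv M x)
    finally have le: "wnorm (u' - v') \<le> 6 * M\<^sup>2 * ?y x" .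
    show ?thesis
      using ev
    proof eventually_elim
      case (elim h)
      also have "\<bar>h\<bar> * (wnorm (u' - v') + e) \<le> \<bar>h\<bar> * (6 * M\<^sup>2 * ?y x + e)"
        using le by (intro mult_left_mono) auto
      finally show ?case .
    qed
  qed
  have y0: "?y 0 = 0"
    using u v by (simp add: truncated_szego_solution_def)
  have y_nonneg: "0 \<le> ?y x" for x
    by (intro wnorm_nonneg W)
  have "?y T = 0"
    by (rule gronwall_zero_of_increment_bound[of T ?y "6 * M\<^sup>2"])
      (use y0 y_nonneg incr in \<open>auto simp: T_def\<close>)
  \<comment> \<open>Backward times: the bound involves \<open>h\<close> only through
    \<open>\<bar>h\<bar>\<close>, so the time-reflected function inherits it.\<close>
  moreover have "?y (- T) = 0"
  proof (rule gronwall_zero_of_increment_bound[of T "\<lambda>t. ?y (- t)" "6 * M\<^sup>2"])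
    fix x e :: real assume "x \<in> {0..T}" "e > 0"
    then have "\<forall>\<^sub>F h in at 0. \<bar>?y (- x + h) - ?y (- x)\<bar> \<le> \<bar>h\<bar> * (6 * M\<^sup>2 * ?y (- x) + e)"
      by (intro incr) auto
    then have "\<forall>\<^sub>F h in filtermap uminus (at (0::real)). \<bar>?y (- x + h) - ?y (- x)\<bar> \<le> \<bar>h\<bar> * (6 * M\<^sup>2 * ?y (- x) + e)"
      using filtermap_at_minus[of "0::real"] by simp
    then show "\<forall>\<^sub>F h in at 0. \<bar>?y (- (x + h)) - ?y (- x)\<bar> \<le> \<bar>h\<bar> * (6 * M\<^sup>2 * ?y (- x) + e)"
      by (simp add: eventually_filtermap minus_diff_commute)
  qed (use y0 y_nonneg in \<open>auto simp: T_def\<close>)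
  ultimately have "?y t = 0"
    by (cases "t \<ge> 0") (auto simp: T_def)
  with wnorm_eq_0D[OF W this] show "u t = v t"
    by simp
qed

section \<open>Power-weighted geometric series\<close>

text \<open>Half of the geometric decay absorbs the power weight.\<close>

lemma powr_mult_power_le:
  fixes a x y :: real
  assumes a: "a > 0" and y: "0 < y" "y \<le> 1" "x = 1 - y"
  shows "(2 + real n) powr a * x ^ n \<le> 3 * (2 * a / y) powr a * sqrt x ^ n"
proof -
  \<comment> \<open>Then \<open>exp z\<close> is \<open>exp y\<close> times
    \<open>exp (n * y / 2)\<close>, and the latter is compensated by one of the two factors
    \<open>sqrt x ^ n\<close> of \<open>x ^ n\<close>.\<close>
  define z where "z = y * (2 + real n) / 2"
  have z: "z > 0" using y by (simp add: z_def)
  have x: "0 \<le> x" using y by simp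
  \<comment> \<open>Exponentiated, this trades the power \<open>z powr a\<close> for
    \<open>a powr a * exp z\<close>.\<close>
  have "ln (z / a) \<le> z / a"
    using ln_le_minus_one[of "z / a"] z a by simp
  then have "a * ln z \<le> a * ln a + z"
    using z a by (simp add: ln_div pos_le_divide_eq right_diff_distrib mult.commute)
  then have "z powr a \<le> a powr a * exp z"
    using z a by (simp add: powr_def flip: exp_add)
  moreover have "(2 + real n) powr a = (2 / y) powr a * z powr a"
  proof -
    have "2 + real n = 2 / y * z" using y by (simp add: z_def)
    then show ?thesis using y z powr_mult[of "2 / y" z a] by simp
  qed
  ultimately have "(2 + real n) powr a \<le> (2 / y) powr a * (a powr a * exp z)"
    by (simp add: mult_left_mono)
  also have "\<dots> = (2 * a / y) powr a * exp z"
    using y a powr_mult[of "2 / y" a a] by simp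
  finally have "(2 + real n) powr a * x ^ n \<le> (2 * a / y) powr a * (exp z * x ^ n)"
    using x by (simp add: mult_right_mono flip: mult.assoc)
  also have "exp z * x ^ n \<le> 3 * sqrt x ^ n"
  proof -
    have "x \<le> exp (- y)"
      using exp_ge_add_one_self[of "- y"] y by simp
    then have "sqrt x \<le> sqrt (exp (- y))" by simp
    also have "\<dots> = exp (- (y / 2))"
      by (rule real_sqrt_unique) (simp_all add: power2_eq_square exp_add[symmetric])
    finally have "exp (y / 2) * sqrt x \<le> 1"
      by (simp add: exp_minus field_simps)
    then have "(exp (y / 2) * sqrt x) ^ n \<le> 1"
      using x by (intro power_le_one) auto
    then have le1: "exp (real n * (y / 2)) * sqrt x ^ n \<le> 1"
      using exp_of_nat_mult[of n "y / 2"] by (simp add: power_mult_distrib)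
    have "z = y + real n * (y / 2)"
      by (simp add: z_def field_simps)
    then have "exp z = exp y * exp (real n * (y / 2))"
      by (simp only: exp_add)
    moreover have "x ^ n = sqrt x ^ n * sqrt x ^ n"
      using x by (simp flip: power_mult_distrib)
    ultimately have "exp z * x ^ n = exp y * (exp (real n * (y / 2)) * sqrt x ^ n) * sqrt x ^ n"
      by (simp only: mult_ac)
    also have "\<dots> \<le> 3 * 1 * sqrt x ^ n"
    proof (intro mult_right_mono mult_mono le1)
      have "exp y \<le> exp 1" using y by simp
      then show "exp y \<le> 3" using exp_le by linarith
    qed (use x in auto)
    finally show ?thesis by simp
  qed
  finally show ?thesis
    by (simp add: mult.assoc mult_left_mono mult.left_commute)
qed

lemma summable_powr_mult_power:
  fixes a x :: real
  assumes a: "a > 0" and x: "0 \<le> x" "x < 1"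
  shows "summable (\<lambda>n. (2 + real n) powr a * x ^ n)"
proof (rule summable_comparison_test')
  show "summable (\<lambda>n. 3 * (2 * a / (1 - x)) powr a * sqrt x ^ n)"
    using x by (intro summable_mult summable_geometric) auto
  show "norm ((2 + real n) powr a * x ^ n) \<le> 3 * (2 * a / (1 - x)) powr a * sqrt x ^ n" for n
    using powr_mult_power_le[OF a, of "1 - x" x n] x by simp
qed

text \<open>The remaining geometric series has ratio \<open>?q = sqrt (1 - y)\<close>. Since
  \<open>(1 - ?q) * (1 + ?q) = y\<close> and \<open>?q < 1\<close>, its sum is at most
  \<open>2 / y\<close>, which adds one to the exponent.\<close>

lemma suminf_powr_mult_power_le:
  fixes a y :: real
  assumes a: "a > 0" and y: "0 < y" "y \<le> 1"
  shows "(\<Sum>n. (2 + real n) powr a * (1 - y) ^ n) \<le> 6 * (2 * a) powr a * y powr (- (a + 1))"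
proof -
  let ?q = "sqrt (1 - y)"
  have q: "0 \<le> ?q" "?q < 1" using y by auto
  have "(1 - ?q) * (1 + ?q) = y"
    using y by (simp add: algebra_simps)
  moreover have "(1 - ?q) * (1 + ?q) \<le> (1 - ?q) * 2"
    using q by (intro mult_left_mono) auto
  ultimately have q2: "1 / (1 - ?q) \<le> 2 / y"
    using q y by (simp add: field_simps)
  have "(\<Sum>n. (2 + real n) powr a * (1 - y) ^ n) \<le> (\<Sum>n. 3 * (2 * a / y) powr a * ?q ^ n)"
    using powr_mult_power_le[OF a y refl] summable_powr_mult_power[OF a, of "1 - y"] y q
    by (intro suminf_le summable_mult summable_geometric) auto
  also have "\<dots> = 3 * (2 * a / y) powr a * (1 / (1 - ?q))"
    using q by (simp add: suminf_mult suminf_geometric summable_geometric)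
  also have "\<dots> \<le> 3 * (2 * a / y) powr a * (2 / y)"
    by (intro mult_left_mono q2) auto
  also have "\<dots> = 6 * (2 * a) powr a * y powr (- (a + 1))"
    using y a by (simp only: powr_minus_divide powr_add powr_divide) simp
  finally show ?thesis .
qed

lemma suminf_powr_mult_power_ge:
  fixes a y :: real
  assumes a: "a > 0" and y: "0 < y" "y \<le> 1"
  shows "(2 * y) powr (- (a + 1)) \<le> (\<Sum>n. (2 + real n) powr a * (1 - y) ^ n)"
proof -
  let ?f = "\<lambda>n. (2 + real n) powr a * (1 - y) ^ n"
  \<comment> \<open>The tail from \<open>K\<close> on has the right order already: there \<open>2 + n \<ge> 1 / (2 * y)\<close>,
    while \<open>(1 - y) ^ K \<ge> 1 / 2\<close> by Bernoulli's inequality.\<close>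
  define K where "K = nat \<lfloor>1 / (2 * y)\<rfloor>"
  have K: "real K \<le> 1 / (2 * y)" "1 / (2 * y) \<le> 2 + real K"
    using y by (simp_all add: K_def) linarith+
  have f: "summable ?f"
    using summable_powr_mult_power[OF a, of "1 - y"] y by simp
  have "1 / 2 \<le> 1 - real K * y"
    using K(1) y by (simp add: field_simps)
  also have "\<dots> \<le> (1 - y) ^ K"
    using Bernoulli_inequality[of "- y" K] y by simp
  finally have pow: "1 / 2 \<le> (1 - y) ^ K" .
  have "(2 * y) powr (- (a + 1)) = (1 / (2 * y)) powr a * (1 / 2) * (1 / y)"
    using y by (simp only: powr_minus_divide powr_add powr_divide) simp
  also have "\<dots> \<le> (2 + real K) powr a * (1 - y) ^ K * (1 / y)"
    using y K a pow by (intro mult_right_mono mult_mono powr_mono2) auto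
  also have "\<dots> = (\<Sum>n. (2 + real K) powr a * (1 - y) ^ K * (1 - y) ^ n)"
    using y by (simp add: suminf_mult suminf_geometric summable_geometric)
  also have "\<dots> \<le> (\<Sum>n. ?f (n + K))"
  proof (intro suminf_le)
    show "(2 + real K) powr a * (1 - y) ^ K * (1 - y) ^ n \<le> ?f (n + K)" for n
      using y a by (auto intro!: mult_left_mono powr_mono2 simp: power_add mult_ac)
    show "summable (\<lambda>n. (2 + real K) powr a * (1 - y) ^ K * (1 - y) ^ n)"
      using y by (intro summable_mult summable_geometric) auto
    show "summable (\<lambda>n. ?f (n + K))"
      by (rule summable_ignore_initial_segment[OF f])
  qed
  also have "\<dots> \<le> suminf ?f"
    using suminf_split_initial_segment[OF f, of K] y by (simp add: sum_nonneg)
  finally show ?thesis .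
qed

section \<open>The nonlinearity on geometric profiles\<close>

text \<open>The coefficients of \<open>b + c z / (1 - p z)\<close>. As \<open>p ^ 0 = 1\<close>, the
  value \<open>p = 0\<close> belongs to the family and gives the polynomial
  \<open>b + c z\<close>.\<close>

definition geometric_profile :: "complex \<Rightarrow> complex \<Rightarrow> complex \<Rightarrow> complex fps" where
  "geometric_profile b c p = Abs_fps (\<lambda>n. case n of 0 \<Rightarrow> b | Suc m \<Rightarrow> c * p ^ m)"

lemma geometric_profile_nth [simp]:
  "fps_nth (geometric_profile b c p) 0 = b"
  "fps_nth (geometric_profile b c p) (Suc m) = c * p ^ m"
  by (simp_all add: geometric_profile_def)

text \<open>The geometric part starts at index 1, which turns the weight base \<open>1 + n\<close>
  into \<open>2 + n\<close>.\<close>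

lemma Hs_norm_geometric_profile:
  assumes p: "cmod p < 1" and s: "s > 1/2"
  shows "geometric_profile b c p \<in> Hs_plus s"
    "(Hs_norm s (geometric_profile b c p))\<^sup>2
      = (cmod b)\<^sup>2 + (cmod c)\<^sup>2 * (\<Sum>n. (2 + real n) powr (2 * s) * ((cmod p)\<^sup>2) ^ n)"
proof -
  let ?f = "\<lambda>n. (1 + real n) powr (2 * s) * (cmod (fps_nth (geometric_profile b c p) n))\<^sup>2"
  let ?S = "\<Sum>n. (2 + real n) powr (2 * s) * ((cmod p)\<^sup>2) ^ n"
  have p2: "(cmod p)\<^sup>2 < 1"
    using p by (simp add: power_less_one_iff abs_square_less_1)
  have "(\<lambda>n. (2 + real n) powr (2 * s) * ((cmod p)\<^sup>2) ^ n) sums ?S"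
    using summable_powr_mult_power[of "2 * s" "(cmod p)\<^sup>2"] p2 s by (simp add: summable_sums)
  from sums_mult[OF this, of "(cmod c)\<^sup>2"]
  have "(\<lambda>n. ?f (Suc n)) sums ((cmod c)\<^sup>2 * ?S)"
    by (simp add: norm_mult norm_power power_mult_distrib power_mult[symmetric] mult_ac)
  from sums_Suc[OF this]
  have f: "?f sums ((cmod c)\<^sup>2 * ?S + (cmod b)\<^sup>2)"
    by simp
  then show "geometric_profile b c p \<in> Hs_plus s"
    by (auto simp: Hs_plus_def sums_iff)
  have "0 \<le> suminf ?f"
    using sums_summable[OF f] by (intro suminf_nonneg) auto
  then show "(Hs_norm s (geometric_profile b c p))\<^sup>2 = (cmod b)\<^sup>2 + (cmod c)\<^sup>2 * ?S"
    using sums_unique[OF f] by (simp add: Hs_norm_def)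
qed

lemma shift_adj_geometric_profile_nth:
  "fps_nth (shift_adj (geometric_profile b c p)) n = c * p ^ n"
  by (simp add: shift_adj_def)

text \<open>The two end terms of the convolution contain \<open>b\<close>; each of the
  \<open>m\<close> inner terms equals \<open>c\<^sup>2 * p ^ (m - 1)\<close>. At
  \<open>m = 0\<close> the truncated exponent is multiplied by 0.\<close>

lemma geometric_profile_square_nth:
  "fps_nth (geometric_profile b c p * geometric_profile b c p) 0 = b\<^sup>2"
  "fps_nth (geometric_profile b c p * geometric_profile b c p) (Suc m)
    = 2 * b * c * p ^ m + c\<^sup>2 * (of_nat m * p ^ (m - 1))"
proof -
  show "fps_nth (geometric_profile b c p * geometric_profile b c p) 0 = b\<^sup>2"
    by (simp add: fps_mult_nth power2_eq_square)
  have "fps_nth (geometric_profile b c p * geometric_profile b c p) (Suc m)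
      = b * (c * p ^ m) + (\<Sum>i=0..m. c * p ^ i * fps_nth (geometric_profile b c p) (m - i))"
    unfolding fps_mult_nth by (subst sum.atLeast0_atMost_Suc_shift) simp
  also have "(\<Sum>i=0..m. c * p ^ i * fps_nth (geometric_profile b c p) (m - i))
      = c * p ^ m * b + c\<^sup>2 * (of_nat m * p ^ (m - 1))"
  proof (cases m)
    case (Suc k)
    have "(\<Sum>i=0..k. c * p ^ i * fps_nth (geometric_profile b c p) (Suc k - i)) = (\<Sum>i=0..k. c\<^sup>2 * p ^ k)"
      by (intro sum.cong refl) (auto simp: Suc_diff_le power2_eq_square power_add[symmetric])
    then show ?thesis
      using Suc by (simp add: mult_ac)
  qed simp
  finally show "fps_nth (geometric_profile b c p * geometric_profile b c p) (Suc m)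
      = 2 * b * c * p ^ m + c\<^sup>2 * (of_nat m * p ^ (m - 1))"
    by (simp add: algebra_simps)
qed

lemma shift_adj_geometric_profile_square_nth:
  "fps_nth (shift_adj (geometric_profile b c p) * shift_adj (geometric_profile b c p)) m
    = c\<^sup>2 * (of_nat (Suc m) * p ^ m)"
proof -
  have "fps_nth (shift_adj (geometric_profile b c p) * shift_adj (geometric_profile b c p)) m
      = (\<Sum>i=0..m. c\<^sup>2 * p ^ m)"
    unfolding fps_mult_nth shift_adj_geometric_profile_nth
    by (intro sum.cong refl) (auto simp: power2_eq_square power_add[symmetric])
  then show ?thesis by (simp add: algebra_simps)
qed

lemma geometric_profile_wiener:
  assumes "cmod p < 1"
  shows "geometric_profile b c p \<in> wiener"
proof -
  have "summable (\<lambda>n. cmod (fps_nth (geometric_profile b c p) (Suc n)))"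
    using assms by (simp add: norm_mult norm_power summable_mult summable_geometric)
  then have "summable (\<lambda>n. cmod (fps_nth (geometric_profile b c p) n))"
    by (rule iffD1[OF summable_Suc_iff[of "\<lambda>n. cmod (fps_nth (geometric_profile b c p) n)"]])
  then show ?thesis
    by (simp only: wiener_def mem_Collect_eq)
qed

text \<open>Invariance of the family: at positive index the result combines \<open>p ^ m\<close> and
  \<open>m * p ^ (m - 1)\<close>, the variations of \<open>c * p ^ m\<close> in \<open>c\<close> and
  in \<open>p\<close>.\<close>

lemma truncated_szego_rhs_geometric_profile:
  fixes b c p :: complex
  assumes p: "cmod p < 1"
  defines "x \<equiv> p * cnj p"
  defines "S \<equiv> c * cnj c / (1 - x)"
  shows "fps_nth (truncated_szego_rhs (geometric_profile b c p)) 0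
      = b\<^sup>2 * cnj b + 2 * b * S + S * c * cnj p / (1 - x)"
    and "fps_nth (truncated_szego_rhs (geometric_profile b c p)) (Suc m)
      = (2 * b * cnj b * c + 2 * b * S * p) * p ^ m + cnj b * c\<^sup>2 * (of_nat m * p ^ (m - 1))"
proof -
  let ?u = "geometric_profile b c p"
  let ?h = "shift_adj ?u"
  have u: "?u \<in> wiener" by (rule geometric_profile_wiener[OF p])
  have h: "?h \<in> wiener" by (rule wiener_shift_adj(1)[OF u])
  have x: "cmod x < 1"
    using p by (simp add: x_def norm_mult abs_square_less_1 flip: power2_eq_square)
  \<comment> \<open>The term \<open>l = 0\<close> is split off, being the only one in which the
    conjugated factor contributes \<open>b\<close>.\<close>
  have cubic_u: "fps_nth (szego_cubic ?u) n
      = fps_nth (?u * ?u) n * cnj b + (\<Sum>l. fps_nth (?u * ?u) (Suc (n + l)) * cnj (c * p ^ l))" for n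
    using suminf_split_initial_segment[OF correlation_summable[OF wiener_mult(1)[OF u u] u], of n 1]
    by (simp add: szego_cubic_eq_correlation[OF u] correlation_def add.commute)
  have geo: "(\<lambda>l. x ^ l) sums (1 / (1 - x))"
    by (rule geometric_sums[OF x])
  have pow: "p ^ (n + l) * cnj (p ^ l) = p ^ n * x ^ l" for n l
    by (simp add: x_def power_add power_mult_distrib)
  have S_sums: "(\<lambda>l. 2 * b * c * p ^ (n + l) * cnj (c * p ^ l)) sums (2 * b * S * p ^ n)" for n
    using sums_mult[OF geo, of "2 * b * c * cnj c * p ^ n"] pow[of n]
    by (simp add: S_def mult_ac)
  have "(\<lambda>l. 2 * b * c * p ^ l * cnj (c * p ^ l) + c\<^sup>2 * (of_nat l * p ^ (l - 1)) * cnj (c * p ^ l))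
      sums (2 * b * S + S * c * cnj p / (1 - x))"
  proof (rule sums_add)
    show "(\<lambda>l. 2 * b * c * p ^ l * cnj (c * p ^ l)) sums (2 * b * S)"
      using S_sums[of 0] by simp
    have "(\<lambda>l. of_nat (Suc l) * x ^ l) sums (1 / (1 - x)\<^sup>2)"
      by (rule geometric_deriv_sums[OF x])
    from sums_mult[OF this, of "c\<^sup>2 * cnj c * cnj p"]
    have "(\<lambda>l. c\<^sup>2 * (of_nat (Suc l) * p ^ (Suc l - 1)) * cnj (c * p ^ Suc l)) sums (S * c * cnj p / (1 - x))"
      by (simp add: S_def x_def power2_eq_square power_mult_distrib mult_ac)
    from sums_Suc[OF this]
    show "(\<lambda>l. c\<^sup>2 * (of_nat l * p ^ (l - 1)) * cnj (c * p ^ l)) sums (S * c * cnj p / (1 - x))"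
      by simp
  qed
  then show "fps_nth (truncated_szego_rhs ?u) 0 = b\<^sup>2 * cnj b + 2 * b * S + S * c * cnj p / (1 - x)"
    by (simp add: truncated_szego_rhs_def shift_def cubic_u geometric_profile_square_nth distrib_right sums_iff
        power2_eq_square)
  have h_sums: "(\<lambda>l. c\<^sup>2 * (of_nat (Suc (m + l)) * p ^ (m + l)) * cnj (c * p ^ l)) sums fps_nth (szego_cubic ?h) m"
    using summable_sums[OF correlation_summable[OF wiener_mult(1)[OF h h] h, of m]]
    by (simp add: szego_cubic_eq_correlation[OF h] correlation_def shift_adj_geometric_profile_square_nth shift_adj_geometric_profile_nth)
  \<comment> \<open>The inner part of the square of \<open>?u\<close> at index \<open>k + 2\<close>
    is the square of \<open>?h\<close> at index \<open>k\<close>. Its contribution is therefore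
    exactly the subtracted cubic term.\<close>
  have "(\<lambda>l. fps_nth (?u * ?u) (Suc (Suc m + l)) * cnj (c * p ^ l))
      = (\<lambda>l. 2 * b * c * p ^ (Suc m + l) * cnj (c * p ^ l)
           + c\<^sup>2 * (of_nat (Suc (m + l)) * p ^ (m + l)) * cnj (c * p ^ l))"
    by (simp add: geometric_profile_square_nth distrib_right del: of_nat_Suc)
  also have "\<dots> sums (2 * b * S * p ^ Suc m + fps_nth (szego_cubic ?h) m)"
    by (intro sums_add S_sums h_sums)
  finally have "fps_nth (szego_cubic ?u) (Suc m) - fps_nth (szego_cubic ?h) m
      = fps_nth (?u * ?u) (Suc m) * cnj b + 2 * b * S * p ^ Suc m"
    unfolding cubic_u by (simp add: sums_iff)
  then show "fps_nth (truncated_szego_rhs ?u) (Suc m)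
      = (2 * b * cnj b * c + 2 * b * S * p) * p ^ m + cnj b * c\<^sup>2 * (of_nat m * p ^ (m - 1))"
    by (simp add: truncated_szego_rhs_def shift_def geometric_profile_square_nth algebra_simps)
qed

section \<open>Curves of geometric profiles\<close>

lemma has_vector_derivative_increment_le:
  fixes f :: "real \<Rightarrow> complex"
  assumes f: "\<And>x. x \<in> {a..b} \<Longrightarrow> (f has_vector_derivative f' x) (at x)"
    and B: "\<And>x. x \<in> {a..b} \<Longrightarrow> norm (f' x) \<le> B" and xy: "x \<in> {a..b}" "y \<in> {a..b}"
  shows "norm (f x - f y) \<le> B * \<bar>x - y\<bar>"
proof -
  have "norm (f x - f y) \<le> B * norm (x - y)"
  proof (rule differentiable_bound[of "{a..b}" f "\<lambda>x h. h *\<^sub>R f' x"])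
    show "(f has_derivative (\<lambda>h. h *\<^sub>R f' x)) (at x within {a..b})" if "x \<in> {a..b}" for x
      using f[OF that] by (simp add: has_vector_derivative_def has_derivative_at_withinI)
    show "onorm (\<lambda>h. h *\<^sub>R f' x) \<le> B" if "x \<in> {a..b}" for x
      using B[OF that] by (intro onorm_le) (auto simp: mult.commute[of B] intro!: mult_left_mono)
  qed (use xy in auto)
  then show ?thesis by simp
qed

text \<open>Dominated convergence for the series of the squared norm: each coefficient of the error
  tends to 0, and the mean value inequality bounds it by \<open>2 * B n\<close>.\<close>

lemma has_Hs_derivativeI_dominated:
  fixes u :: "real \<Rightarrow> complex fps"
  assumes d: "d > 0"
    and deriv: "\<And>n x. \<bar>x - t\<bar> \<le> d \<Longrightarrow> ((\<lambda>x. fps_nth (u x) n) has_vector_derivative u' x n) (at x)"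
    and bound: "\<And>n x. \<bar>x - t\<bar> \<le> d \<Longrightarrow> cmod (u' x n) \<le> B n"
    and B: "summable (\<lambda>n. (1 + real n) powr (2 * s) * (B n)\<^sup>2)"
  shows "has_Hs_derivative s u (Abs_fps (u' t)) t"
proof -
  let ?w = "\<lambda>n. (1 + real n) powr (2 * s)"
  let ?q = "\<lambda>h. fps_const (complex_of_real (1 / h)) * (u (t + h) - u t) - Abs_fps (u' t)"
  have "Abs_fps (u' t) \<in> Hs_plus s"
    unfolding Hs_plus_def mem_Collect_eq
  proof (rule summable_comparison_test'[OF B])
    show "norm (?w n * (cmod (fps_nth (Abs_fps (u' t)) n))\<^sup>2) \<le> ?w n * (B n)\<^sup>2" for n
      using bound[of t n] d by (auto intro!: mult_left_mono power_mono)
  qed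
  moreover have "((\<lambda>h. Hs_norm s (?q h)) \<longlongrightarrow> 0) (at 0)"
  proof -
    have lim: "((\<lambda>h. ?w n * (cmod (fps_nth (?q h) n))\<^sup>2) \<longlongrightarrow> 0) (at 0)" for n
    proof -
      have "((\<lambda>x. fps_nth (u x) n) has_vector_derivative u' t n) (at t)"
        using deriv d by simp
      then have "((\<lambda>h. norm (fps_nth (u (t + h)) n - fps_nth (u t) n - h *\<^sub>R u' t n) / norm h) \<longlongrightarrow> 0) (at 0)"
        by (simp add: has_vector_derivative_def has_derivative_at)
      then have "((\<lambda>h. norm (fps_nth (?q h) n)) \<longlongrightarrow> 0) (at 0)"
      proof (rule Lim_transform_eventually)
        have "norm (fps_nth (u (t + h)) n - fps_nth (u t) n - h *\<^sub>R u' t n) / norm h = norm (fps_nth (?q h) n)"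
          if "h \<noteq> 0" for h
        proof -
          have "fps_nth (?q h) n = (fps_nth (u (t + h)) n - fps_nth (u t) n - h *\<^sub>R u' t n) / of_real h"
            using that by (simp add: scaleR_conv_of_real diff_divide_distrib)
          then show ?thesis by (simp only: norm_divide norm_of_real real_norm_def)
        qed
        then show "\<forall>\<^sub>F h in at 0. norm (fps_nth (u (t + h)) n - fps_nth (u t) n - h *\<^sub>R u' t n) / norm h = norm (fps_nth (?q h) n)"
          by (simp add: eventually_at_filter)
      qed
      then have "((\<lambda>h. fps_nth (?q h) n) \<longlongrightarrow> 0) (at 0)"
        by (simp only: tendsto_norm_zero_iff)
      then have "((\<lambda>h. ?w n * (cmod (fps_nth (?q h) n))\<^sup>2) \<longlongrightarrow> ?w n * (cmod 0)\<^sup>2) (at 0)"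
        by (intro tendsto_intros)
      then show ?thesis by simp
    qed
    have le: "norm (?w n * (cmod (fps_nth (?q h) n))\<^sup>2) \<le> 4 * (?w n * (B n)\<^sup>2)"
      if h: "h \<noteq> 0" "\<bar>h\<bar> \<le> d" for n h
    proof -
      have "norm (fps_nth (u (t + h)) n - fps_nth (u t) n) \<le> B n * \<bar>t + h - t\<bar>"
        by (rule has_vector_derivative_increment_le[of "t - d" "t + d" "\<lambda>x. fps_nth (u x) n" "\<lambda>x. u' x n"])
          (use deriv bound h in auto)
      then have "norm (complex_of_real (1 / h) * (fps_nth (u (t + h)) n - fps_nth (u t) n)) \<le> B n"
        using h by (simp add: norm_mult norm_divide field_simps)
      then have "cmod (fps_nth (?q h) n) \<le> B n + B n"
        using bound[of t n] d norm_triangle_ineq4[of "complex_of_real (1 / h) * (fps_nth (u (t + h)) n - fps_nth (u t) n)" "u' t n"]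
        by simp
      then have "(cmod (fps_nth (?q h) n))\<^sup>2 \<le> (B n + B n)\<^sup>2"
        by (intro power_mono) auto
      then have "?w n * (cmod (fps_nth (?q h) n))\<^sup>2 \<le> ?w n * (B n + B n)\<^sup>2"
        by (intro mult_left_mono) auto
      then show ?thesis
        by (simp add: power2_eq_square algebra_simps)
    qed
    have "\<forall>\<^sub>F h in at 0. h \<noteq> 0 \<and> \<bar>h\<bar> \<le> d"
      using d by (auto simp: eventually_at intro!: exI[of _ d])
    then have E: "\<forall>\<^sub>F h in at 0. \<forall>n. norm (?w n * (cmod (fps_nth (?q h) n))\<^sup>2) \<le> 4 * (?w n * (B n)\<^sup>2)"
      by eventually_elim (use le in blast)
    have "\<forall>\<^sub>F (n, h) in at_top \<times>\<^sub>F at 0. norm (?w n * (cmod (fps_nth (?q h) n))\<^sup>2) \<le> 4 * (?w n * (B n)\<^sup>2)"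
      using eventually_prodI[of "\<lambda>_. True" at_top, OF eventually_True E]
      by (rule eventually_mono) auto
    from tannerys_theorem[OF lim this] B
    have "((\<lambda>h. \<Sum>n. ?w n * (cmod (fps_nth (?q h) n))\<^sup>2) \<longlongrightarrow> 0) (at 0)"
      by (auto intro: summable_mult)
    from tendsto_real_sqrt[OF this] show ?thesis
      by (simp add: Hs_norm_def)
  qed
  ultimately show ?thesis
    by (simp add: has_Hs_derivative_def)
qed

lemma has_Hs_derivative_geometric_profile:
  fixes b c p :: "real \<Rightarrow> complex"
  assumes s: "s > 1/2" and p1: "\<And>x. cmod (p x) < 1"
    and b: "\<And>x. (b has_vector_derivative b' x) (at x)" "continuous_on UNIV b'"
    and c: "\<And>x. (c has_vector_derivative c' x) (at x)" "continuous_on UNIV c'"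
    and p: "\<And>x. (p has_vector_derivative p' x) (at x)" "continuous_on UNIV p'"
  shows "has_Hs_derivative s (\<lambda>x. geometric_profile (b x) (c x) (p x))
    (Abs_fps (\<lambda>n. case n of 0 \<Rightarrow> b' t | Suc m \<Rightarrow> c' t * p t ^ m + c t * (of_nat m * p t ^ (m - 1) * p' t))) t"
proof -
  let ?I = "{t - 1..t + 1}"
  have bdd: "\<exists>M. \<forall>x\<in>?I. cmod (f x) \<le> M" if "continuous_on UNIV f" for f :: "real \<Rightarrow> complex"
  proof -
    have "compact (f ` ?I)"
      using that by (intro compact_continuous_image continuous_on_subset[OF that]) auto
    then show ?thesis
      using compact_imp_bounded by (fastforce simp: bounded_iff)
  qed
  have cont: "continuous_on UNIV f" if "\<And>x. (f has_vector_derivative f' x) (at x)" for f f' :: "real \<Rightarrow> complex"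
    using that by (auto intro!: continuous_at_imp_continuous_on has_vector_derivative_continuous)
  obtain M1 M2 M3 M4 where M: "\<And>x. x \<in> ?I \<Longrightarrow> cmod (b' x) \<le> M1" "\<And>x. x \<in> ?I \<Longrightarrow> cmod (c x) \<le> M2"
    "\<And>x. x \<in> ?I \<Longrightarrow> cmod (c' x) \<le> M3" "\<And>x. x \<in> ?I \<Longrightarrow> cmod (p' x) \<le> M4"
    using bdd[OF b(2)] bdd[OF cont[OF c(1)]] bdd[OF c(2)] bdd[OF p(2)] by metis
  define A where "A = Max {M1, M2, M3, M4, 0}"
  have A: "A \<ge> 0" and bA: "\<And>x. x \<in> ?I \<Longrightarrow> cmod (b' x) \<le> A" and cA: "\<And>x. x \<in> ?I \<Longrightarrow> cmod (c x) \<le> A"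
    and c'A: "\<And>x. x \<in> ?I \<Longrightarrow> cmod (c' x) \<le> A" and p'A: "\<And>x. x \<in> ?I \<Longrightarrow> cmod (p' x) \<le> A"
    using M by (auto simp: A_def le_max_iff_disj)
  have "continuous_on ?I (\<lambda>x. cmod (p x))"
    by (intro continuous_on_norm continuous_on_subset[OF cont[OF p(1)]]) auto
  then have "\<exists>x0\<in>?I. \<forall>x\<in>?I. cmod (p x) \<le> cmod (p x0)"
    by (intro continuous_attains_sup) auto
  then obtain x0 where x0: "\<And>x. x \<in> ?I \<Longrightarrow> cmod (p x) \<le> cmod (p x0)"
    by blast
  \<comment> \<open>A common radius below 1 for nearby times. The lower bound 1/2 permits division
    by \<open>\<rho>\<close> even where \<open>p\<close> vanishes.\<close>
  define \<rho> where "\<rho> = max (1/2) (cmod (p x0))"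
  have \<rho>: "0 < \<rho>" "\<rho> < 1" and p\<rho>: "\<And>x. x \<in> ?I \<Longrightarrow> cmod (p x) \<le> \<rho>"
    using p1[of x0] x0 by (auto simp: \<rho>_def le_max_iff_disj)
  let ?u' = "\<lambda>x n. case n of 0 \<Rightarrow> b' x | Suc m \<Rightarrow> c' x * p x ^ m + c x * (of_nat m * p x ^ (m - 1) * p' x)"
  \<comment> \<open>At index \<open>n = m + 1\<close>, the term with \<open>p ^ m\<close> lacks one
    factor \<open>\<rho>\<close> and the term with \<open>p ^ (m - 1)\<close> lacks two.\<close>
  define K where "K = A / \<rho> + A * A / (\<rho> * \<rho>)"
  have K: "K \<ge> 0" using A \<rho> by (simp add: K_def)
  show ?thesis
  proof (rule has_Hs_derivativeI_dominated[of 1 t "\<lambda>x. geometric_profile (b x) (c x) (p x)" ?u' "\<lambda>n. K * ((1 + real n) * \<rho> ^ n)"])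
    fix n and x :: real assume "\<bar>x - t\<bar> \<le> 1"
    then have x: "x \<in> ?I" by auto
    show "((\<lambda>x. fps_nth (geometric_profile (b x) (c x) (p x)) n) has_vector_derivative ?u' x n) (at x)"
    proof (cases n)
      case 0
      then show ?thesis using b(1) by simp
    next
      case (Suc m)
      have "((\<lambda>x. p x ^ m) has_vector_derivative of_nat m * p x ^ (m - 1) * p' x) (at x)"
      proof -
        have "((\<lambda>z. z ^ m) has_field_derivative of_nat m * p x ^ (m - 1)) (at (p x))"
          by (auto intro!: derivative_eq_intros)
        from field_vector_diff_chain_at[OF p(1) this] show ?thesis
          by (simp add: o_def mult.commute)
      qed
      from has_vector_derivative_mult[OF c(1) this] show ?thesis
        using Suc by (simp add: add.commute)
    qed
    show "cmod (?u' x n) \<le> K * ((1 + real n) * \<rho> ^ n)"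
    proof (cases n)
      case 0
      have "A \<le> A / \<rho>" using A \<rho> by (simp add: le_divide_eq mult_left_le)
      then show ?thesis using 0 bA[OF x] A \<rho> by (simp add: K_def add_increasing2)
    next
      case (Suc m)
      have "cmod (c' x * p x ^ m) \<le> A / \<rho> * \<rho> ^ n"
        using mult_mono[OF c'A[OF x] power_mono[OF p\<rho>[OF x], of m]] A \<rho> Suc by (simp add: norm_mult norm_power)
      also have "\<dots> \<le> A / \<rho> * ((1 + real n) * \<rho> ^ n)"
        using A \<rho> by (intro mult_left_mono) auto
      finally have 1: "cmod (c' x * p x ^ m) \<le> A / \<rho> * ((1 + real n) * \<rho> ^ n)" .
      have "cmod (c x * (of_nat m * p x ^ (m - 1) * p' x)) \<le> A * (real m * \<rho> ^ (m - 1) * A)"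
        unfolding norm_mult norm_power norm_of_nat
        using A \<rho> cA[OF x] p'A[OF x] p\<rho>[OF x] by (intro mult_mono power_mono) auto
      also have "\<dots> \<le> A * A / (\<rho> * \<rho>) * ((1 + real n) * \<rho> ^ n)"
      proof (cases m)
        case 0
        then show ?thesis using A \<rho> by simp
      next
        case (Suc k)
        have "A * A * (real m * \<rho> ^ k) \<le> A * A * ((1 + real n) * \<rho> ^ k)"
          using A \<rho> \<open>n = Suc m\<close> by (intro mult_left_mono mult_right_mono) auto
        then show ?thesis
          using Suc \<open>n = Suc m\<close> \<rho> by (simp add: mult_ac)
      qed
      finally have 2: "cmod (c x * (of_nat m * p x ^ (m - 1) * p' x)) \<le> A * A / (\<rho> * \<rho>) * ((1 + real n) * \<rho> ^ n)" .
      show ?thesis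
        using Suc norm_triangle_le[OF add_mono[OF 1 2]] by (simp add: K_def distrib_right)
    qed
  next
    have \<rho>2: "\<rho>\<^sup>2 < 1" using \<rho> by (simp add: abs_square_less_1)
    have S: "summable (\<lambda>n. K\<^sup>2 * ((2 + real n) powr (2 * s + 2) * (\<rho>\<^sup>2) ^ n))"
      using s \<rho> \<rho>2 by (intro summable_mult summable_powr_mult_power) auto
    show "summable (\<lambda>n. (1 + real n) powr (2 * s) * (K * ((1 + real n) * \<rho> ^ n))\<^sup>2)"
    proof (rule summable_comparison_test'[OF S])
      fix n
      have "(1 + real n) powr (2 * s) * (1 + real n)\<^sup>2 = (1 + real n) powr (2 * s + 2)"
        by (simp add: powr_add)
      also have "\<dots> \<le> (2 + real n) powr (2 * s + 2)"
        using s by (intro powr_mono2) auto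
      finally have "K\<^sup>2 * ((\<rho>\<^sup>2) ^ n * ((1 + real n) powr (2 * s) * (1 + real n)\<^sup>2)) \<le> K\<^sup>2 * ((\<rho>\<^sup>2) ^ n * (2 + real n) powr (2 * s + 2))"
        by (intro mult_left_mono) auto
      then show "norm ((1 + real n) powr (2 * s) * (K * ((1 + real n) * \<rho> ^ n))\<^sup>2)
          \<le> K\<^sup>2 * ((2 + real n) powr (2 * s + 2) * (\<rho>\<^sup>2) ^ n)"
        using \<rho> by (simp add: power_mult_distrib abs_mult mult_ac flip: power_mult)
    qed
  qed simp
qed

section \<open>An explicit turbulent orbit\<close>

text \<open>The three ODEs match the coefficient of index 0 and, at positive index, the multiples of
  \<open>p ^ m\<close> and of \<open>m * p ^ (m - 1)\<close>.\<close>

lemma truncated_szego_solution_geometric_profile: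
  fixes b c p :: "real \<Rightarrow> complex"
  assumes s: "s > 1/2" and p1: "\<And>x. cmod (p x) < 1"
    and b: "\<And>x. (b has_vector_derivative b' x) (at x)" "continuous_on UNIV b'"
    and c: "\<And>x. (c has_vector_derivative c' x) (at x)" "continuous_on UNIV c'"
    and p: "\<And>x. (p has_vector_derivative p' x) (at x)" "continuous_on UNIV p'"
    and S: "\<And>t. S t = c t * cnj (c t) / (1 - p t * cnj (p t))"
    and ode_b: "\<And>t. \<i> * b' t = (b t)\<^sup>2 * cnj (b t) + 2 * b t * S t + S t * c t * cnj (p t) / (1 - p t * cnj (p t))"
    and ode_c: "\<And>t. \<i> * c' t = 2 * b t * cnj (b t) * c t + 2 * b t * S t * p t"
    and ode_p: "\<And>t. \<i> * p' t = cnj (b t) * c t"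
  shows "truncated_szego_solution s (geometric_profile (b 0) (c 0) (p 0))
    (\<lambda>t. geometric_profile (b t) (c t) (p t))"
proof -
  let ?u' = "\<lambda>t. Abs_fps (\<lambda>n. case n of 0 \<Rightarrow> b' t
    | Suc m \<Rightarrow> c' t * p t ^ m + c t * (of_nat m * p t ^ (m - 1) * p' t))"
  have eq: "fps_const \<i> * ?u' t = truncated_szego_rhs (geometric_profile (b t) (c t) (p t))" for t
  proof (rule fps_ext)
    fix n
    show "fps_nth (fps_const \<i> * ?u' t) n = fps_nth (truncated_szego_rhs (geometric_profile (b t) (c t) (p t))) n"
    proof (cases n)
      case 0
      then show ?thesis
        using ode_b[of t] by (simp add: truncated_szego_rhs_geometric_profile(1)[OF p1] S)
    next
      case (Suc m)
      have "\<i> * (c' t * p t ^ m + c t * (of_nat m * p t ^ (m - 1) * p' t))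
          = (\<i> * c' t) * p t ^ m + c t * (of_nat m * p t ^ (m - 1)) * (\<i> * p' t)"
        by (simp add: algebra_simps)
      also have "\<dots> = (2 * b t * cnj (b t) * c t + 2 * b t * S t * p t) * p t ^ m
          + cnj (b t) * (c t)\<^sup>2 * (of_nat m * p t ^ (m - 1))"
        unfolding ode_c ode_p by (simp add: power2_eq_square mult_ac)
      finally show ?thesis
        using Suc by (simp add: truncated_szego_rhs_geometric_profile(2)[OF p1] S)
    qed
  qed
  show ?thesis
    unfolding truncated_szego_solution_def truncated_szego_rhs_def[symmetric]
    by (intro conjI refl allI exI[of _ ?u'] eq Hs_norm_geometric_profile(1)[OF p1 s]
        has_Hs_derivative_geometric_profile[OF s p1 b c p])
qed

text \<open>
  On geometric profiles \<open>N = |b|\<^sup>2 + |c|\<^sup>2 / y\<close> and \<open>J = |c|\<^sup>2 / y\<^sup>2\<close>, with \<open>y = 1 - |p|\<^sup>2\<close>, are conserved,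
  and if the energy equals \<open>N\<^sup>2\<close> then conservation laws reduce the dynamics to
  \<open>y'\<^sup>2 = 4 * y\<^sup>2 * (N * J - N\<^sup>2 / 4 - (J\<^sup>2 + N * J / 4) * y + 7 / 16 * J\<^sup>2 * y\<^sup>2)\<close>.
  For \<open>N = 3\<close>, \<open>J = 2\<close> the bracket factors as \<open>(1 - y) * (15 - 7 * y) / 4\<close>; \<open>r\<close> and \<open>g\<close> are signed
  square roots of the factors \<open>1 - y\<close> and \<open>15 - 7 * y\<close>.  All phases are linear in \<open>t\<close> and \<open>Y = \<integral>y\<close>.
\<close>

lemma turbulent_orbit_exists:
  obtains r g Y :: "real \<Rightarrow> real" where
    "r 0 = 0"
    "\<And>t. (g t)\<^sup>2 = 8 + 7 * (r t)\<^sup>2"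
    "\<And>t. 1 - (r t)\<^sup>2 = 15 / (15 + 8 * (sinh (sqrt 15 / 2 * t))\<^sup>2)"
    "\<And>t. (r has_real_derivative (1 - (r t)\<^sup>2) * g t / 2) (at t)"
    "\<And>t. (g has_real_derivative 7 * (1 - (r t)\<^sup>2) * r t / 2) (at t)"
    "\<And>t. (Y has_real_derivative 1 - (r t)\<^sup>2) (at t)"
proof -
  let ?sh = "\<lambda>t. sinh (sqrt 15 / 2 * t)" and ?ch = "\<lambda>t. cosh (sqrt 15 / 2 * t)"
  \<comment> \<open>For \<open>N = 3\<close>, \<open>J = 2\<close> the quantity
    \<open>v = 1 / y\<close> satisfies \<open>v'\<^sup>2 = (v - 1) * (15 * v - 7)\<close>, which
    hyperbolic functions solve; \<open>w\<close> is chosen with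
    \<open>w\<^sup>2 = 15 * v\<close>.\<close>
  define w where "w t = sqrt (15 + 8 * (?sh t)\<^sup>2)" for t
  have D: "15 + 8 * (?sh t)\<^sup>2 > 0" for t
    by (simp add: add_pos_nonneg)
  have w: "w t > 0" "(w t)\<^sup>2 = 15 + 8 * (?sh t)\<^sup>2" "(w t)\<^sup>2 = 7 + 8 * (?ch t)\<^sup>2" for t
    using D[of t] by (simp_all add: w_def cosh_square_eq)
  have w': "(w has_real_derivative 4 * sqrt 15 * ?sh t * ?ch t / w t) (at t)" for t
    unfolding w_def using D[of t]
    by (auto intro!: derivative_eq_intros simp: field_simps)
  \<comment> \<open>The sign of \<open>sinh\<close> keeps \<open>r\<close> smooth through the
    turning point \<open>y = 1\<close>, where the nonnegative root of \<open>1 - y\<close> has a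
    corner.\<close>
  define r where "r t = sqrt 8 * ?sh t / w t" for t
  define g where "g t = sqrt 15 * sqrt 8 * ?ch t / w t" for t
  have y: "1 - (r t)\<^sup>2 = 15 / (w t)\<^sup>2" for t
  proof -
    have "1 - (r t)\<^sup>2 = ((w t)\<^sup>2 - 8 * (?sh t)\<^sup>2) / (w t)\<^sup>2"
      using w(1)[of t] by (simp add: r_def power_divide power_mult_distrib diff_divide_distrib)
    then show ?thesis
      using w(2)[of t] by simp
  qed
  have r0: "r 0 = 0" by (simp add: r_def)
  have g_pos: "g t > 0" for t
    using w(1)[of t] by (simp add: g_def)
  have g_sq: "(g t)\<^sup>2 = 8 + 7 * (r t)\<^sup>2" for t
  proof -
    have "(g t)\<^sup>2 = 15 * 8 * (?ch t)\<^sup>2 / (w t)\<^sup>2"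
      by (simp add: g_def power_divide power_mult_distrib)
    also have "\<dots> = 15 * ((w t)\<^sup>2 - 7) / (w t)\<^sup>2"
      using w(3)[of t] by simp
    also have "\<dots> = 15 - 7 * (15 / (w t)\<^sup>2)"
      using w(1)[of t] by (simp add: field_simps)
    finally show ?thesis
      using y[of t] by simp
  qed
  have r': "(r has_real_derivative (1 - (r t)\<^sup>2) * g t / 2) (at t)" for t
  proof -
    have "(r has_real_derivative (sqrt 8 * (?ch t * (sqrt 15 / 2)) * w t
        - sqrt 8 * ?sh t * (4 * sqrt 15 * ?sh t * ?ch t / w t)) / (w t * w t)) (at t)"
      unfolding r_def using w(1)[of t] by (auto intro!: derivative_eq_intros w')
    moreover have "(sqrt 8 * (?ch t * (sqrt 15 / 2)) * w t
        - sqrt 8 * ?sh t * (4 * sqrt 15 * ?sh t * ?ch t / w t)) / (w t * w t)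
        = ((w t)\<^sup>2 - 8 * (?sh t)\<^sup>2) / (w t)\<^sup>2 * g t / 2"
      using w(1)[of t] by (simp add: g_def field_simps power2_eq_square)
    ultimately show ?thesis
      using y[of t] w(2)[of t] by simp
  qed
  have g': "(g has_real_derivative 7 * (1 - (r t)\<^sup>2) * r t / 2) (at t)" for t
  proof -
    have "(g has_real_derivative (sqrt 15 * sqrt 8 * (?sh t * (sqrt 15 / 2)) * w t
        - sqrt 15 * sqrt 8 * ?ch t * (4 * sqrt 15 * ?sh t * ?ch t / w t)) / (w t * w t)) (at t)"
      unfolding g_def using w(1)[of t] by (auto intro!: derivative_eq_intros w')
    moreover have "(sqrt 15 * sqrt 8 * (?sh t * (sqrt 15 / 2)) * w t
        - sqrt 15 * sqrt 8 * ?ch t * (4 * sqrt 15 * ?sh t * ?ch t / w t)) / (w t * w t)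
        = (sqrt 15)\<^sup>2 * ((w t)\<^sup>2 - 8 * (?ch t)\<^sup>2) / (w t)\<^sup>2 * r t / 2"
      using w(1)[of t] by (simp add: r_def field_simps power2_eq_square del: real_sqrt_mult_self)
    ultimately show ?thesis
      using y[of t] w(3)[of t] by simp
  qed
  \<comment> \<open>\<open>g + sqrt 7 * r\<close> has logarithmic derivative \<open>sqrt 7 / 2 * (1 - r\<^sup>2)\<close>.\<close>
  define Y where "Y t = 2 / sqrt 7 * ln (g t + sqrt 7 * r t)" for t
  have pos: "g t + sqrt 7 * r t > 0" for t
  proof -
    have "\<bar>sqrt 7 * r t\<bar>\<^sup>2 < (g t)\<^sup>2"
      using g_sq[of t] by (simp add: power_mult_distrib)
    then have "\<bar>sqrt 7 * r t\<bar> < g t"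
      by (rule power2_less_imp_less) (use g_pos[of t] in simp)
    then show ?thesis by linarith
  qed
  have "(Y has_real_derivative 1 - (r t)\<^sup>2) (at t)" for t
  proof -
    from DERIV_cmult[OF DERIV_chain2[OF DERIV_ln[OF pos] DERIV_add[OF g' DERIV_cmult[OF r']]], of "2 / sqrt 7" t]
    have "(Y has_real_derivative 2 / sqrt 7 * ((7 * (1 - (r t)\<^sup>2) * r t / 2 + sqrt 7 * ((1 - (r t)\<^sup>2) * g t / 2)) / (g t + sqrt 7 * r t))) (at t)"
      by (simp only: Y_def[abs_def] divide_inverse mult_ac)
    moreover have "k * k * y * r t / 2 + k * (y * g t / 2) = k / 2 * y * (g t + k * r t)" for k y :: real
      by (simp add: field_simps)
    from this[of "sqrt 7" "1 - (r t)\<^sup>2"]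
    have "7 * (1 - (r t)\<^sup>2) * r t / 2 + sqrt 7 * ((1 - (r t)\<^sup>2) * g t / 2)
        = sqrt 7 / 2 * (1 - (r t)\<^sup>2) * (g t + sqrt 7 * r t)"
      by simp
    moreover have "2 / sqrt 7 * (sqrt 7 / 2 * y * Z / Z) = y" if "Z > 0" for y Z :: real
      using that by simp
    ultimately show ?thesis
      by (simp only: pos)
  qed
  then show ?thesis
    using that[of r g Y] r0 g_sq y r' g' w(2) by simp
qed

section \<open>Phases and Sobolev norms along the orbit\<close>

lemma has_vector_derivative_polar:
  fixes R \<theta> :: "real \<Rightarrow> real"
  assumes "(R has_real_derivative R') (at t)" "(\<theta> has_real_derivative \<theta>') (at t)"
  shows "((\<lambda>t. of_real (R t) * cis (\<theta> t)) has_vector_derivative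
    (of_real R' + \<i> * of_real (R t * \<theta>')) * cis (\<theta> t)) (at t)"
proof -
  have cis': "(cis has_vector_derivative \<i> * cis x) (at x)" for x
  proof -
    have "((\<lambda>z. exp (\<i> * z)) has_field_derivative \<i> * exp (\<i> * of_real x)) (at (of_real x))"
      by (auto intro!: derivative_eq_intros)
    from has_vector_derivative_real_field[OF this, of UNIV] show ?thesis
      by (simp add: cis_conv_exp[abs_def])
  qed
  have "((cis \<circ> \<theta>) has_vector_derivative \<theta>' *\<^sub>R (\<i> * cis (\<theta> t))) (at t)"
    using vector_diff_chain_at[OF _ cis'] assms(2) by (simp add: has_real_derivative_iff_has_vector_derivative)
  moreover have "((\<lambda>t. complex_of_real (R t)) has_vector_derivative of_real R') (at t)"
    using assms(1) by (simp add: has_vector_derivative_of_real has_real_derivative_iff_has_vector_derivative)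
  ultimately have "((\<lambda>t. of_real (R t) * (cis \<circ> \<theta>) t) has_vector_derivative
      of_real (R t) * (\<theta>' *\<^sub>R (\<i> * cis (\<theta> t))) + of_real R' * (cis \<circ> \<theta>) t) (at t)"
    by (intro has_vector_derivative_mult)
  then show ?thesis
    by (simp add: algebra_simps scaleR_conv_of_real)
qed

text \<open>Here \<open>J = 2\<close> fixes \<open>\<bar>c\<bar>\<^sup>2\<close>, and
  \<open>N = 3\<close> bounds \<open>\<bar>b\<bar>\<^sup>2\<close>. The series is of order
  \<open>y powr (- (2 * s + 1))\<close>, and the constant from \<open>b\<close> is absorbed because
  \<open>y powr (1 - 2 * s) \<ge> 1\<close>.\<close>

lemma Hs_norm_geometric_profile_bounds:
  fixes b c p :: complex and y :: real
  assumes s: "s > 1/2" and y: "0 < y" and p: "(cmod p)\<^sup>2 = 1 - y"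
    and b: "(cmod b)\<^sup>2 \<le> 3" and c: "(cmod c)\<^sup>2 = 2 * y\<^sup>2"
  shows "2 powr (- (2 * s)) * y powr (1 - 2 * s) \<le> (Hs_norm s (geometric_profile b c p))\<^sup>2"
    and "(Hs_norm s (geometric_profile b c p))\<^sup>2 \<le> (3 + 12 * (4 * s) powr (2 * s)) * y powr (1 - 2 * s)"
proof -
  let ?S = "\<Sum>n. (2 + real n) powr (2 * s) * (1 - y) ^ n"
  have y1: "y \<le> 1"
    using p zero_le_power2[of "cmod p"] by linarith
  have "(cmod p)\<^sup>2 < 1" using p y by simp
  then have p1: "cmod p < 1" by (simp add: abs_square_less_1)
  have N: "(Hs_norm s (geometric_profile b c p))\<^sup>2 = (cmod b)\<^sup>2 + 2 * y\<^sup>2 * ?S"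
    using Hs_norm_geometric_profile(2)[OF p1 s] by (simp add: p c)
  have pow: "y\<^sup>2 * y powr (- (2 * s + 1)) = y powr (1 - 2 * s)"
    using y powr_add[of y 2 "- (2 * s + 1)"] by simp
  have "2 powr (- (2 * s)) * y powr (1 - 2 * s) = 2 * y\<^sup>2 * (2 * y) powr (- (2 * s + 1))"
    using y powr_add[of 2 1 "- (2 * s + 1)"] unfolding pow[symmetric] by (simp add: powr_mult)
  also have "\<dots> \<le> 2 * y\<^sup>2 * ?S"
    using suminf_powr_mult_power_ge[of "2 * s" y] s y y1 by (intro mult_left_mono) auto
  finally show "2 powr (- (2 * s)) * y powr (1 - 2 * s) \<le> (Hs_norm s (geometric_profile b c p))\<^sup>2"
    unfolding N by (simp add: add_increasing)
  have "2 * y\<^sup>2 * ?S \<le> 2 * y\<^sup>2 * (6 * (2 * (2 * s)) powr (2 * s) * y powr (- (2 * s + 1)))"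
    using suminf_powr_mult_power_le[of "2 * s" y] s y y1 by (intro mult_left_mono) auto
  also have "\<dots> = 12 * (4 * s) powr (2 * s) * y powr (1 - 2 * s)"
    unfolding pow[symmetric] by simp
  finally have "2 * y\<^sup>2 * ?S \<le> 12 * (4 * s) powr (2 * s) * y powr (1 - 2 * s)" .
  moreover have "1 \<le> y powr (1 - 2 * s)"
    using powr_mono'[of "1 - 2 * s" 0 y] s y y1 by simp
  ultimately show "(Hs_norm s (geometric_profile b c p))\<^sup>2 \<le> (3 + 12 * (4 * s) powr (2 * s)) * y powr (1 - 2 * s)"
    unfolding N distrib_right using b by linarith
qed

lemma geometric_profile_in_rational_L1:
  assumes "c \<noteq> 0"
  shows "geometric_profile b c 0 \<in> rational_L1"
proof -
  have "geometric_profile b c 0 = fps_const b + fps_const c * fps_X"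
    by (rule fps_ext) (auto simp: geometric_profile_def split: nat.split)
  then have "(\<lambda>z. poly [:b, c:] z / poly 1 z) has_fps_expansion geometric_profile b c 0"
    by (auto intro!: fps_expansion_intros simp: mult.commute[of _ c])
  moreover have "degree [:b, c:] = 1" using assms by simp
  ultimately show ?thesis
    unfolding rational_L1_def by (intro CollectI exI[of _ "[:b, c:]"] exI[of _ 1]) simp
qed

lemma Hs_norm_nonneg: "f \<in> Hs_plus s \<Longrightarrow> 0 \<le> Hs_norm s f"
  unfolding Hs_norm_def Hs_plus_def by (auto intro!: suminf_nonneg)

text \<open>For \<open>t \<ge> 0\<close>, \<open>y\<close> is comparable to
  \<open>exp (- 2 * k * t)\<close>. The negative exponent reverses the inequalities, and the square
  root halves the rate.\<close>

lemma comparable_exp_of_square_bounds: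
  fixes N y :: "real \<Rightarrow> real"
  assumes s: "s > 1/2" and k: "k > 0" and mM: "0 < m" "m \<le> M"
    and N: "\<And>t. 0 \<le> N t" "\<And>t. m * y t powr (1 - 2 * s) \<le> (N t)\<^sup>2" "\<And>t. (N t)\<^sup>2 \<le> M * y t powr (1 - 2 * s)"
    and y: "\<And>t. y t = 15 / (15 + 8 * (sinh (k * t))\<^sup>2)"
  shows "comparable_at_top N (\<lambda>t. exp ((2 * s - 1) * k * \<bar>t\<bar>))"
proof -
  define a where "a = 2 * s - 1"
  have a: "a > 0" using s by (simp add: a_def)
  have y_bounds: "exp (- (2 * k * t)) \<le> y t" "y t \<le> 15/2 * exp (- (2 * k * t))" if t: "t \<ge> 0" for t
  proof -
    define X where "X = exp (2 * k * t)"
    have X: "X \<ge> 1" using t k by (simp add: X_def)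
    have "exp (k * t) * exp (k * t) = X" "exp (- (k * t)) * exp (- (k * t)) = 1 / X" "exp (k * t) * exp (- (k * t)) = 1"
      by (simp_all add: X_def exp_minus exp_add[symmetric] field_simps flip: exp_add)
    then have "15 + 8 * (sinh (k * t))\<^sup>2 = 11 + 2 * X + 2 / X"
      by (simp add: sinh_field_def power2_eq_square field_simps)
    then have yX: "y t = 15 / (11 + 2 * X + 2 / X)" by (simp add: y)
    have "1 / X \<le> 1" "0 < 1 / X" using X by auto
    then have "11 + 2 * X + 2 / X \<le> 15 * X" "2 * X \<le> 11 + 2 * X + 2 / X"
      using X by linarith+
    then have "15 / (15 * X) \<le> y t" "y t \<le> 15 / (2 * X)"
      unfolding yX using X by (intro divide_left_mono; simp add: add_pos_pos)+
    then show "exp (- (2 * k * t)) \<le> y t" "y t \<le> 15/2 * exp (- (2 * k * t))"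
      by (simp_all add: X_def exp_minus field_simps)
  qed
  define m' where "m' = sqrt (m * (15/2) powr (- a))"
  define M' where "M' = max m' (sqrt M)"
  have "m' * exp (a * k * \<bar>t\<bar>) \<le> N t \<and> N t \<le> M' * exp (a * k * \<bar>t\<bar>)" if t: "t \<ge> 0" for t
  proof -
    have exp_eq: "exp (- (2 * k * t)) powr (- a) = (exp (a * k * t))\<^sup>2"
      by (simp add: powr_def power2_eq_square exp_add[symmetric])
    have y_pos: "y t > 0" using y_bounds(1)[OF t] exp_gt_zero[of "- (2 * k * t)"] by linarith
    have "y t powr (- a) \<le> exp (- (2 * k * t)) powr (- a)"
      using y_bounds(1)[OF t] a by (intro powr_mono2') auto
    then have up: "y t powr (1 - 2 * s) \<le> (exp (a * k * t))\<^sup>2"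
      by (simp only: exp_eq) (simp add: a_def)
    have "(15/2 * exp (- (2 * k * t))) powr (- a) \<le> y t powr (- a)"
      using y_bounds(2)[OF t] a y_pos by (intro powr_mono2') auto
    then have "(15/2) powr (- a) * (exp (a * k * t))\<^sup>2 \<le> y t powr (- a)"
      by (simp only: powr_mult exp_eq)
    then have low: "(15/2) powr (- a) * (exp (a * k * t))\<^sup>2 \<le> y t powr (1 - 2 * s)"
      by (simp add: a_def)
    have "(m' * exp (a * k * t))\<^sup>2 = m * ((15/2) powr (- a) * (exp (a * k * t))\<^sup>2)"
      using mM by (simp add: m'_def power_mult_distrib)
    also have "\<dots> \<le> (N t)\<^sup>2"
      using mult_left_mono[OF low, of m] N(2)[of t] mM by linarith
    finally have 1: "m' * exp (a * k * t) \<le> N t"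
      by (rule power2_le_imp_le) (rule N(1))
    have "(N t)\<^sup>2 \<le> M * (exp (a * k * t))\<^sup>2"
      using mult_left_mono[OF up, of M] N(3)[of t] mM by linarith
    also have "\<dots> = (sqrt M * exp (a * k * t))\<^sup>2"
      using mM by (simp add: power_mult_distrib)
    finally have "N t \<le> sqrt M * exp (a * k * t)"
      by (rule power2_le_imp_le) (use mM in simp)
    also have "\<dots> \<le> M' * exp (a * k * t)"
      by (intro mult_right_mono) (auto simp: M'_def)
    finally show ?thesis using 1 t by simp
  qed
  moreover have "0 < m'" "m' \<le> M'"
    using mM by (simp_all add: m'_def M'_def)
  ultimately show ?thesis
    unfolding comparable_at_top_def a_def by blast
qed

text \<open>
  The primed letters stand for complex conjugates (\<open>R\<close>, \<open>G\<close>, \<open>q\<close> being real); treating them as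
  independent variables makes the ODEs polynomial identities.
\<close>

lemma turbulent_orbit_ode:
  fixes R G q E E' F F' y b b' c p p' :: complex
  assumes q: "q * q = 2" and G: "G\<^sup>2 = 8 + 7 * R\<^sup>2" and E: "E * E' = 1" and F: "F * F' = 1"
    and y: "y = 1 - R\<^sup>2"
    and b: "b = - (q / 4) * (3 * R + \<i> * G) * (E' * F')" and b': "b' = - (q / 4) * (3 * R - \<i> * G) * (E * F)"
    and c: "c = q * y * (E\<^sup>2 * F')" and p: "p = R * E ^ 3" and p': "p' = R * E' ^ 3"
  shows "b * b' = 1 + 2 * R\<^sup>2"
    and "\<i> * ((y * G / 2 + \<i> * (R * (3 / 2 * y))) * E ^ 3) = b' * c"
    and "\<i> * ((- q * (y * R * G) + \<i> * (q * y * (y - 3))) * (E\<^sup>2 * F')) = 2 * b * b' * c + 2 * b * (2 * y) * p"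
    and "\<i> * (- (q / 4) * (3 * (y * G / 2 - \<i> * (R * (y / 2 + 3))) + \<i> * (7 * y * R / 2 - \<i> * (G * (y / 2 + 3)))) * (E' * F'))
      = b\<^sup>2 * b' + 2 * b * (2 * y) + 2 * y * c * p' / y"
proof -
  \<comment> \<open>The phases cancel, and \<open>9 * R\<^sup>2 + G\<^sup>2\<close> becomes
    \<open>8 + 16 * R\<^sup>2\<close>.\<close>
  have "b * b' = q * q / 16 * (9 * R\<^sup>2 - \<i> * \<i> * G\<^sup>2) * (E * E') * (F * F')"
    unfolding b b' by (simp add: field_simps power2_eq_square)
  also have "\<dots> = 1 + 2 * R\<^sup>2"
    unfolding q E F G by (simp add: field_simps)
  finally show bb: "b * b' = 1 + 2 * R\<^sup>2" .
  have "b' * c = - (q * q / 4) * (3 * R - \<i> * G) * y * E ^ 3 * (F * F')"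
    unfolding b' c by (simp add: field_simps power2_eq_square power3_eq_cube)
  also have "\<dots> = \<i> * ((y * G / 2 + \<i> * (R * (3 / 2 * y))) * E ^ 3)"
    unfolding q F by (simp add: field_simps)
  finally show "\<i> * ((y * G / 2 + \<i> * (R * (3 / 2 * y))) * E ^ 3) = b' * c" ..
  have "b * p = - (q / 4) * (3 * R + \<i> * G) * R * (E * E') * (E\<^sup>2 * F')"
    unfolding b p by (simp add: field_simps power2_eq_square power3_eq_cube)
  then have bp: "b * p = - (q / 4) * (3 * R + \<i> * G) * R * (E\<^sup>2 * F')"
    unfolding E by simp
  have "2 * b * b' * c + 2 * b * (2 * y) * p = 2 * (b * b') * c + 4 * y * (b * p)"
    by simp
  also have "\<dots> = q * y * (E\<^sup>2 * F') * (2 * (1 + 2 * R\<^sup>2) - (3 * R + \<i> * G) * R)"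
    unfolding bb bp c by (simp add: algebra_simps)
  also have "\<dots> = \<i> * ((- q * (y * R * G) + \<i> * (q * y * (y - 3))) * (E\<^sup>2 * F'))"
    unfolding y by (simp add: algebra_simps power2_eq_square)
  finally show "\<i> * ((- q * (y * R * G) + \<i> * (q * y * (y - 3))) * (E\<^sup>2 * F')) = 2 * b * b' * c + 2 * b * (2 * y) * p" ..
  have "y * c * p' / y = q * y * R * (E * E')\<^sup>2 * (E' * F')"
    unfolding c p' by (simp add: power2_eq_square power3_eq_cube)
  then have cp: "y * c * p' / y = q * y * R * (E' * F')"
    unfolding E by simp
  have "b\<^sup>2 * b' + 2 * b * (2 * y) + 2 * y * c * p' / y = b * (b * b') + 4 * y * b + 2 * (y * c * p' / y)"
    by (simp add: power2_eq_square)
  also have "\<dots> = - (q / 4) * ((3 * R + \<i> * G) * (1 + 2 * R\<^sup>2 + 4 * y) - 8 * y * R) * (E' * F')"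
    unfolding bb cp unfolding b by (simp add: field_simps)
  also have "1 + 2 * R\<^sup>2 + 4 * y = 3 + 2 * y"
    unfolding y by simp
  also have "- (q / 4) * ((3 * R + \<i> * G) * (3 + 2 * y) - 8 * y * R) * (E' * F')
      = \<i> * (- (q / 4) * (3 * (y * G / 2 - \<i> * (R * (y / 2 + 3))) + \<i> * (7 * y * R / 2 - \<i> * (G * (y / 2 + 3)))) * (E' * F'))"
    by (simp add: field_simps)
  finally show "\<i> * (- (q / 4) * (3 * (y * G / 2 - \<i> * (R * (y / 2 + 3))) + \<i> * (7 * y * R / 2 - \<i> * (G * (y / 2 + 3)))) * (E' * F'))
      = b\<^sup>2 * b' + 2 * b * (2 * y) + 2 * y * c * p' / y" ..
qed

theorem mainTheorem4:
  "\<exists>u0 \<in> rational_L1. \<exists>u :: real \<Rightarrow> complex fps.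
     (\<forall>s > 1/2. truncated_szego_solution s u0 u \<and>
        (\<forall>v. truncated_szego_solution s u0 v \<longrightarrow> v = u)) \<and>
     (\<exists>c > 0. \<forall>s > 1/2.
        comparable_at_top (\<lambda>t. Hs_norm s (u t)) (\<lambda>t. exp ((2 * s - 1) * c * \<bar>t\<bar>)))"
proof -
  obtain r g Y :: "real \<Rightarrow> real" where r0: "r 0 = 0"
    and g_sq: "\<And>t. (g t)\<^sup>2 = 8 + 7 * (r t)\<^sup>2"
    and y: "\<And>t. 1 - (r t)\<^sup>2 = 15 / (15 + 8 * (sinh (sqrt 15 / 2 * t))\<^sup>2)"
    and r': "\<And>t. (r has_real_derivative (1 - (r t)\<^sup>2) * g t / 2) (at t)"
    and g': "\<And>t. (g has_real_derivative 7 * (1 - (r t)\<^sup>2) * r t / 2) (at t)"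
    and Y': "\<And>t. (Y has_real_derivative 1 - (r t)\<^sup>2) (at t)"
    by (rule turbulent_orbit_exists) blast
  have y_pos: "1 - (r t)\<^sup>2 > 0" for t
    unfolding y by (intro divide_pos_pos) (auto intro: add_pos_nonneg)
  \<comment> \<open>The square root of \<open>J = 2\<close>, the constant ratio of
    \<open>\<bar>c\<bar>\<close> to \<open>1 - \<bar>p\<bar>\<^sup>2\<close>.\<close>
  define q where "q = complex_of_real (sqrt 2)"
  define R where "R t = complex_of_real (r t)" for t
  define G where "G t = complex_of_real (g t)" for t
  define y where "y t = 1 - (R t)\<^sup>2" for t
  define E where "E t = cis (Y t / 2)" for t
  define F where "F t = cis (3 * t)" for t
  define \<psi> where "\<psi> t = - (Y t / 2 + 3 * t)" for t
  define p where "p t = of_real (r t) * cis (3 / 2 * Y t)" for t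
  define c where "c t = of_real (sqrt 2 * (1 - (r t)\<^sup>2)) * cis (Y t - 3 * t)" for t
  \<comment> \<open>Solved from \<open>\<i> * p' = cnj b * c\<close> with the chosen
    \<open>p\<close> and \<open>c\<close>: the factor \<open>3 * r\<close> stems from the rotation
    of \<open>p\<close>, the factor \<open>g\<close> from its radial motion.\<close>
  define b where "b t = - (q / 4) * (3 * (of_real (r t) * cis (\<psi> t)) + \<i> * (of_real (g t) * cis (\<psi> t)))" for t
  define p' where "p' t = (of_real ((1 - (r t)\<^sup>2) * g t / 2)
    + \<i> * of_real (r t * (3 / 2 * (1 - (r t)\<^sup>2)))) * cis (3 / 2 * Y t)" for t
  define c' where "c' t = (of_real (- sqrt 2 * ((1 - (r t)\<^sup>2) * r t * g t))
    + \<i> * of_real (sqrt 2 * (1 - (r t)\<^sup>2) * ((1 - (r t)\<^sup>2) - 3))) * cis (Y t - 3 * t)" for t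
  define b' where "b' t = - (q / 4) *
    (3 * ((of_real ((1 - (r t)\<^sup>2) * g t / 2) + \<i> * of_real (r t * - ((1 - (r t)\<^sup>2) / 2 + 3))) * cis (\<psi> t))
     + \<i> * ((of_real (7 * (1 - (r t)\<^sup>2) * r t / 2) + \<i> * of_real (g t * - ((1 - (r t)\<^sup>2) / 2 + 3))) * cis (\<psi> t)))" for t
  have \<psi>': "(\<psi> has_real_derivative - ((1 - (r t)\<^sup>2) / 2 + 3)) (at t)" for t
    unfolding \<psi>_def by (auto intro!: derivative_eq_intros Y')
  have p_deriv: "(p has_vector_derivative p' t) (at t)" for t
    unfolding p_def p'_def
    by (rule has_vector_derivative_polar[OF r']) (auto intro!: derivative_eq_intros Y')
  have c_deriv: "(c has_vector_derivative c' t) (at t)" for t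
    unfolding c_def c'_def
    by (rule has_vector_derivative_polar) (auto intro!: derivative_eq_intros Y' r')
  have b_deriv: "(b has_vector_derivative b' t) (at t)" for t
    unfolding b_def b'_def
    by (intro has_vector_derivative_mult_right has_vector_derivative_add has_vector_derivative_polar r' g' \<psi>')
  have cont: "continuous_on UNIV f" if "\<And>t. (f has_real_derivative f' t) (at t)" for f f' :: "real \<Rightarrow> real"
    using that by (meson DERIV_isCont continuous_at_imp_continuous_on)
  note conts = cont[OF r'] cont[OF g'] cont[OF Y'] cont[OF \<psi>']
  have p'_cont: "continuous_on UNIV p'" and c'_cont: "continuous_on UNIV c'" and b'_cont: "continuous_on UNIV b'"
    unfolding p'_def c'_def b'_def by (auto intro!: continuous_intros conts)
  have y_of_real: "y t = of_real (1 - (r t)\<^sup>2)" for t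
    by (simp add: y_def R_def)
  have y_nonzero: "y t \<noteq> 0" for t
    unfolding y_of_real of_real_eq_0_iff using y_pos[of t] by simp
  have q: "q * q = 2" and cnj_q: "cnj q = q"
    by (simp_all add: q_def flip: of_real_mult)
  have EF: "E t * cnj (E t) = 1" "F t * cnj (F t) = 1" for t
    by (simp_all add: E_def F_def cis_cnj cis_mult)
  have G2: "(G t)\<^sup>2 = 8 + 7 * (R t)\<^sup>2" for t
    using arg_cong[OF g_sq[of t], of complex_of_real] by (simp add: G_def R_def)
  have cis_psi: "cis (\<psi> t) = cnj (E t) * cnj (F t)"
    and cis_c: "cis (Y t - 3 * t) = (E t)\<^sup>2 * cnj (F t)"
    and cis_p: "cis (3 / 2 * Y t) = E t ^ 3" for t
    by (simp_all add: \<psi>_def E_def F_def cis_cnj cis_mult Complex.DeMoivre)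
  have cnj_RG: "cnj (R t) = R t" "cnj (G t) = G t" "cnj (y t) = y t" for t
    by (simp_all add: R_def G_def y_def)
  have of_real_eq: "complex_of_real (r t) = R t" "complex_of_real (g t) = G t"
    "complex_of_real (sqrt 2 * (1 - (r t)\<^sup>2)) = q * y t" for t
    by (simp_all add: R_def G_def y_def q_def)
  have b_eq: "b t = - (q / 4) * (3 * R t + \<i> * G t) * (cnj (E t) * cnj (F t))"
    and b_cnj: "cnj (b t) = - (q / 4) * (3 * R t - \<i> * G t) * (E t * F t)"
    and c_eq: "c t = q * y t * ((E t)\<^sup>2 * cnj (F t))"
    and p_eq: "p t = R t * E t ^ 3"
    and p_cnj: "cnj (p t) = R t * cnj (E t) ^ 3" for t
    unfolding b_def c_def p_def cis_psi cis_c cis_p of_real_eq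
    by (simp_all add: cnj_RG cnj_q algebra_simps)
  note ode = turbulent_orbit_ode[OF q G2 EF y_def b_eq b_cnj c_eq p_eq p_cnj]
  have pp: "1 - p t * cnj (p t) = y t" for t
  proof -
    have "p t * cnj (p t) = (R t)\<^sup>2 * (E t * cnj (E t)) ^ 3"
      unfolding p_eq by (simp add: cnj_RG power2_eq_square power_mult_distrib)
    then show ?thesis
      by (simp add: EF y_def)
  qed
  have cc: "c t * cnj (c t) = 2 * (y t)\<^sup>2" for t
  proof -
    have "c t * cnj (c t) = q * q * (y t)\<^sup>2 * (E t * cnj (E t))\<^sup>2 * (F t * cnj (F t))"
      unfolding c_eq by (simp add: cnj_q cnj_RG power2_eq_square)
    then show ?thesis
      by (simp add: EF q)
  qed
  have S: "c t * cnj (c t) / (1 - p t * cnj (p t)) = 2 * y t" for t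
    unfolding pp cc using y_nonzero[of t] by (simp add: power2_eq_square)
  have cmod_p: "(cmod (p t))\<^sup>2 = 1 - (1 - (r t)\<^sup>2)" for t
    by (simp add: p_def norm_mult)
  have cmod_c: "(cmod (c t))\<^sup>2 = 2 * (1 - (r t)\<^sup>2)\<^sup>2" for t
    by (simp add: c_def norm_mult power_mult_distrib del: of_real_mult)
  have cmod_b: "(cmod (b t))\<^sup>2 \<le> 3" for t
  proof -
    have "complex_of_real ((cmod (b t))\<^sup>2) = of_real (1 + 2 * (r t)\<^sup>2)"
      unfolding complex_norm_square ode(1) by (simp add: R_def)
    then have "(cmod (b t))\<^sup>2 = 1 + 2 * (r t)\<^sup>2"
      by (simp only: of_real_eq_iff)
    then show ?thesis
      using y_pos[of t] by simp
  qed
  have p1: "cmod (p t) < 1" for t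
    using y_pos[of t] by (simp add: p_def norm_mult abs_square_less_1)
  let ?u = "\<lambda>t. geometric_profile (b t) (c t) (p t)"
  have sol: "truncated_szego_solution s (?u 0) ?u" if s: "s > 1/2" for s
  proof (rule truncated_szego_solution_geometric_profile[OF s p1 b_deriv b'_cont c_deriv c'_cont p_deriv p'_cont,
        where S = "\<lambda>t. 2 * y t"])
    fix t
    show "2 * y t = c t * cnj (c t) / (1 - p t * cnj (p t))"
      by (rule S[symmetric])
    show "\<i> * p' t = cnj (b t) * c t"
      unfolding ode(2)[of t, symmetric] p'_def cis_p by (simp add: R_def G_def y_def)
    show "\<i> * c' t = 2 * b t * cnj (b t) * c t + 2 * b t * (2 * y t) * p t"
      unfolding ode(3)[of t, symmetric] c'_def cis_c by (simp add: R_def G_def y_def q_def)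
    show "\<i> * b' t = (b t)\<^sup>2 * cnj (b t) + 2 * b t * (2 * y t) + 2 * y t * c t * cnj (p t) / (1 - p t * cnj (p t))"
      unfolding pp ode(4)[of t, symmetric] b'_def cis_psi by (simp add: R_def G_def y_def algebra_simps)
  qed
  \<comment> \<open>Time 0 is the turning point of the orbit: \<open>p\<close> vanishes there and
    the datum is a polynomial of degree 1.\<close>
  have "?u 0 \<in> rational_L1"
  proof -
    have "p 0 = 0" "c 0 \<noteq> 0" using r0 by (simp_all add: p_def c_def)
    then show ?thesis by (simp add: geometric_profile_in_rational_L1)
  qed
  \<comment> \<open>The same explicit curve serves every \<open>s\<close>; uniqueness is then
    applied in each space separately.\<close>
  moreover have "\<forall>s>1/2. truncated_szego_solution s (?u 0) ?u \<and>
      (\<forall>v. truncated_szego_solution s (?u 0) v \<longrightarrow> v = ?u)"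
    using sol truncated_szego_solution_unique by blast
  moreover have "comparable_at_top (\<lambda>t. Hs_norm s (?u t)) (\<lambda>t. exp ((2 * s - 1) * (sqrt 15 / 2) * \<bar>t\<bar>))"
    if s: "s > 1/2" for s
  proof (rule comparable_exp_of_square_bounds[where y = "\<lambda>t. 1 - (r t)\<^sup>2", OF s])
    show "0 < (2::real) powr (- (2 * s))" by simp
    have "(2::real) powr (- (2 * s)) \<le> 1"
      using powr_mono[of "- (2 * s)" 0 "2::real"] s by simp
    moreover have "0 \<le> 12 * (4 * s) powr (2 * s)" by simp
    ultimately show "(2::real) powr (- (2 * s)) \<le> 3 + 12 * (4 * s) powr (2 * s)"
      by linarith
    show "0 \<le> Hs_norm s (?u t)" for t
      by (rule Hs_norm_nonneg[OF Hs_norm_geometric_profile(1)[OF p1 s]])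
  qed (use y Hs_norm_geometric_profile_bounds[OF s y_pos cmod_p cmod_b cmod_c] in auto)
  ultimately show ?thesis
    by (intro bexI[of _ "?u 0"] exI[of _ ?u] conjI exI[of _ "sqrt 15 / 2"]) auto
qed

end
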